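(* Let $A$ be a separable C*-algebra, let $B\subseteq A$ be a closed *-subalgebra containing an approximate unit for $A$, let $P:A\to B$ be a conditional expectation, let $M$ be a slice, and let $\tau$ be the element of the multiplier algebra of $R(M)$ described in the context. Then there exists an isometric virtual commutant $\varphi$ of $B$ in $A$ whose domain is $\overline{P(M)}=\overline{\tau R(M)}$, and such that $$\varphi(P(m))=\tau^{1/2}m\qquad\text{for all } m\in M.$$ Moreover the range of $\varphi$ is precisely $\overline{\tau^{1/2}M}$.
   Context: The normalizer of $B$ in $A$ is $N(B)=\{a\in A: a^*Ba\subseteq B,\ aBa^*\subseteq B\}$. A slice is a closed linear subspace $M\subseteq A$ with $M\subseteq N(B)$, $BM\subseteq M$ and $MB\subseteq M$. $R(M)$ denotes the closed linear span of $\{mn^*:m,n\in M\}$, which is a closed two-sided ideal of $B$. The element $\tau$ is the unique central positive element of the multiplier algebra of $R(M)$ with $\|\tau\|\le1$ and $\tau mn^*=P(m)P(n^* )$ for all $m,n\in M$ (such an element exists). A slice $M$ is a left module over the multiplier algebra of $R(M)$: every $m\in M$ can be written $m=an$ with $a\in R(M)$, $n\in M$, and for a multiplier $\mu$ one puts $\mu m:=(\mu a)n$, which is well defined; this gives meaning to $\tau^{1/2}m$. A virtual commutant of $B$ in $A$ is a linear map $\varphi:J\to A$ defined on a closed two-sided ideal $J$ of $B$ such that $\varphi(bx)=b\varphi(x)$ and $\varphi(xb)=\varphi(x)b$ for all $x\in J$, $b\in B$. Bars denote norm closure. *)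

theory Defs
  imports "HOL-Analysis.Analysis"
begin

section \<open>C*-algebras\<close>

text \<open>A (not necessarily unital) C*-algebra is the universe of a type of the following class.\<close>

class cstar_algebra = banach + real_normed_algebra +
  fixes scaleC :: "complex \<Rightarrow> 'a \<Rightarrow> 'a" (infixr \<open>*\<^sub>C\<close> 75)
    and adj :: "'a \<Rightarrow> 'a" (\<open>_\<^sup>\<star>\<close> [1000] 999)
  assumes scaleC_add_right: "c *\<^sub>C (x + y) = c *\<^sub>C x + c *\<^sub>C y"
    and scaleC_add_left: "(c + d) *\<^sub>C x = c *\<^sub>C x + d *\<^sub>C x"
    and scaleC_scaleC: "c *\<^sub>C (d *\<^sub>C x) = (c * d) *\<^sub>C x"
    and scaleC_of_real: "complex_of_real r *\<^sub>C x = r *\<^sub>R x"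
    and mult_scaleC_left: "(c *\<^sub>C x) * y = c *\<^sub>C (x * y)"
    and mult_scaleC_right: "x * (c *\<^sub>C y) = c *\<^sub>C (x * y)"
    and norm_scaleC: "norm (c *\<^sub>C x) = cmod c * norm x"
    and adj_add: "(x + y)\<^sup>\<star> = x\<^sup>\<star> + y\<^sup>\<star>"
    and adj_scaleC: "(c *\<^sub>C x)\<^sup>\<star> = cnj c *\<^sub>C x\<^sup>\<star>"
    and adj_mult: "(x * y)\<^sup>\<star> = y\<^sup>\<star> * x\<^sup>\<star>"
    and adj_adj: "(x\<^sup>\<star>)\<^sup>\<star> = x"
    and cstar_identity: "norm (x\<^sup>\<star> * x) = (norm x)\<^sup>2"

instantiation complex :: cstar_algebra
begin

definition scaleC_complex :: "complex \<Rightarrow> complex \<Rightarrow> complex" where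
  "scaleC_complex c x = c * x"

definition adj_complex :: "complex \<Rightarrow> complex" where
  "adj_complex = cnj"

instance
  by standard
    (auto simp: scaleC_complex_def adj_complex_def algebra_simps scaleR_conv_of_real
      norm_mult power2_eq_square)

end

global_interpretation cvec: vector_space "scaleC :: complex \<Rightarrow> 'a \<Rightarrow> 'a::cstar_algebra"
  defines csubspace = cvec.subspace
    and cspan = cvec.span
proof
  show "1 *\<^sub>C x = x" for x :: 'a
    using scaleC_of_real[of 1 x] by simp
qed (simp_all add: scaleC_add_right scaleC_add_left scaleC_scaleC)

definition clinear_on :: "'a::cstar_algebra set \<Rightarrow> ('a \<Rightarrow> 'a) \<Rightarrow> bool" where
  "clinear_on S f \<longleftrightarrow>
     (\<forall>x\<in>S. \<forall>y\<in>S. f (x + y) = f x + f y) \<and> (\<forall>c. \<forall>x\<in>S. f (c *\<^sub>C x) = c *\<^sub>C f x)"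

definition positive_element :: "'a::cstar_algebra \<Rightarrow> bool" where
  "positive_element a \<longleftrightarrow> (\<exists>x. a = x\<^sup>\<star> * x)"

definition closed_star_subalgebra :: "'a::cstar_algebra set \<Rightarrow> bool" where
  "closed_star_subalgebra B \<longleftrightarrow>
     closed B \<and> csubspace B \<and> (\<forall>x\<in>B. \<forall>y\<in>B. x * y \<in> B) \<and> (\<forall>x\<in>B. x\<^sup>\<star> \<in> B)"

definition closed_ideal :: "'a::cstar_algebra set \<Rightarrow> 'a set \<Rightarrow> bool" where
  "closed_ideal B J \<longleftrightarrow>
     J \<subseteq> B \<and> closed J \<and> csubspace J \<and> (\<forall>b\<in>B. \<forall>x\<in>J. b * x \<in> J \<and> x * b \<in> J)"

text \<open>An approximate unit is a net of positive contractions \<open>e\<close> with \<open>ea \<rightarrow> a\<close> and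
  \<open>ae \<rightarrow> a\<close> for all \<open>a\<close>. The net is represented by its tail filter, so that no
  index type has to be quantified.\<close>

definition contains_approximate_unit :: "'a::cstar_algebra set \<Rightarrow> bool" where
  "contains_approximate_unit B \<longleftrightarrow>
     (\<exists>F. F \<noteq> bot \<and> (\<forall>\<^sub>F e in F. e \<in> B \<and> positive_element e \<and> norm e \<le> 1) \<and>
          (\<forall>a. ((\<lambda>e. e * a) \<longlongrightarrow> a) F \<and> ((\<lambda>e. a * e) \<longlongrightarrow> a) F))"

definition conditional_expectation :: "'a::cstar_algebra set \<Rightarrow> ('a \<Rightarrow> 'a) \<Rightarrow> bool" where
  "conditional_expectation B P \<longleftrightarrow>
     clinear_on UNIV P \<and> (\<forall>x. P x \<in> B) \<and> (\<forall>b\<in>B. P b = b) \<and>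
     (\<forall>b\<in>B. \<forall>x. P (b * x) = b * P x \<and> P (x * b) = P x * b) \<and>
     (\<forall>x. positive_element x \<longrightarrow> positive_element (P x)) \<and>
     (\<forall>x. norm (P x) \<le> norm x)"


section \<open>Slices and virtual commutants\<close>

definition normalizer :: "'a::cstar_algebra set \<Rightarrow> 'a set" where
  "normalizer B = {a. (\<forall>b\<in>B. a\<^sup>\<star> * b * a \<in> B) \<and> (\<forall>b\<in>B. a * b * a\<^sup>\<star> \<in> B)}"

definition slice :: "'a::cstar_algebra set \<Rightarrow> 'a set \<Rightarrow> bool" where
  "slice B M \<longleftrightarrow>
     closed M \<and> csubspace M \<and> M \<subseteq> normalizer B \<and> (\<forall>b\<in>B. \<forall>m\<in>M. b * m \<in> M \<and> m * b \<in> M)"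

definition slice_ideal :: "'a::cstar_algebra set \<Rightarrow> 'a set" where
  "slice_ideal M = closure (cspan {m * n\<^sup>\<star> | m n. m \<in> M \<and> n \<in> M})"

definition virtual_commutant :: "'a::cstar_algebra set \<Rightarrow> 'a set \<Rightarrow> ('a \<Rightarrow> 'a) \<Rightarrow> bool" where
  "virtual_commutant B J \<phi> \<longleftrightarrow>
     closed_ideal B J \<and> clinear_on J \<phi> \<and>
     (\<forall>x\<in>J. \<forall>b\<in>B. \<phi> (b * x) = b * \<phi> x \<and> \<phi> (x * b) = \<phi> x * b)"


section \<open>The multiplier algebra\<close>

text \<open>Multipliers of a closed *-subalgebra \<open>I\<close> are double centralizers \<open>(L, R)\<close>, that is,
  \<open>L x = \<mu>x\<close> and \<open>R x = x\<mu>\<close>. The maps are taken extensional on \<open>I\<close>, so that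
  equality of multipliers is equality of pairs.\<close>

type_synonym 'a multiplier = "('a \<Rightarrow> 'a) \<times> ('a \<Rightarrow> 'a)"

definition bounded_clinear_on :: "'a::cstar_algebra set \<Rightarrow> ('a \<Rightarrow> 'a) \<Rightarrow> bool" where
  "bounded_clinear_on S f \<longleftrightarrow> clinear_on S f \<and> (\<exists>K. \<forall>x\<in>S. norm (f x) \<le> K * norm x)"

definition multiplier_algebra :: "'a::cstar_algebra set \<Rightarrow> 'a multiplier set" where
  "multiplier_algebra I = {(L, R).
     L \<in> I \<rightarrow>\<^sub>E I \<and> R \<in> I \<rightarrow>\<^sub>E I \<and> bounded_clinear_on I L \<and> bounded_clinear_on I R \<and>
     (\<forall>x\<in>I. \<forall>y\<in>I. L (x * y) = L x * y \<and> R (x * y) = x * R y \<and> x * L y = R x * y)}"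

definition mult_times :: "'a set \<Rightarrow> 'a multiplier \<Rightarrow> 'a multiplier \<Rightarrow> 'a multiplier" where
  "mult_times I \<mu> \<nu> = (compose I (fst \<mu>) (fst \<nu>), compose I (snd \<nu>) (snd \<mu>))"

definition mult_adj :: "'a::cstar_algebra set \<Rightarrow> 'a multiplier \<Rightarrow> 'a multiplier" where
  "mult_adj I \<mu> = (\<lambda>x\<in>I. (snd \<mu> (x\<^sup>\<star>))\<^sup>\<star>, \<lambda>x\<in>I. (fst \<mu> (x\<^sup>\<star>))\<^sup>\<star>)"

definition mult_norm :: "'a::cstar_algebra set \<Rightarrow> 'a multiplier \<Rightarrow> real" where
  "mult_norm I \<mu> = (SUP x\<in>{x \<in> I. norm x \<le> 1}. norm (fst \<mu> x))"

definition mult_positive :: "'a::cstar_algebra set \<Rightarrow> 'a multiplier \<Rightarrow> bool" where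
  "mult_positive I \<mu> \<longleftrightarrow> (\<exists>\<nu>\<in>multiplier_algebra I. \<mu> = mult_times I (mult_adj I \<nu>) \<nu>)"

definition mult_central :: "'a::cstar_algebra set \<Rightarrow> 'a multiplier \<Rightarrow> bool" where
  "mult_central I \<mu> \<longleftrightarrow> (\<forall>\<nu>\<in>multiplier_algebra I. mult_times I \<mu> \<nu> = mult_times I \<nu> \<mu>)"

definition mult_sqrt :: "'a::cstar_algebra set \<Rightarrow> 'a multiplier \<Rightarrow> 'a multiplier" where
  "mult_sqrt I \<mu> =
     (THE \<sigma>. \<sigma> \<in> multiplier_algebra I \<and> mult_positive I \<sigma> \<and> mult_times I \<sigma> \<sigma> = \<mu>)"

text \<open>The left action of multipliers of \<open>slice_ideal M\<close> on \<open>M\<close>: \<open>\<mu>m = (\<mu>a)n\<close> for any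
  factorization \<open>m = an\<close>.\<close>

definition slice_action :: "'a::cstar_algebra set \<Rightarrow> 'a multiplier \<Rightarrow> 'a \<Rightarrow> 'a" where
  "slice_action M \<mu> m = (THE x. \<exists>a\<in>slice_ideal M. \<exists>n\<in>M. m = a * n \<and> x = fst \<mu> a * n)"

definition is_tau :: "('a::cstar_algebra \<Rightarrow> 'a) \<Rightarrow> 'a set \<Rightarrow> 'a multiplier \<Rightarrow> bool" where
  "is_tau P M \<tau> \<longleftrightarrow>
     \<tau> \<in> multiplier_algebra (slice_ideal M) \<and>
     mult_central (slice_ideal M) \<tau> \<and> mult_positive (slice_ideal M) \<tau> \<and>
     mult_norm (slice_ideal M) \<tau> \<le> 1 \<and>
     (\<forall>m\<in>M. \<forall>n\<in>M. fst \<tau> (m * n\<^sup>\<star>) = P m * P (n\<^sup>\<star>))"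

end

theory Submission
  imports Defs
begin

text \<open>Put \<open>\<sigma> = \<tau>\<^sup>1\<^sup>/\<^sup>2\<close>. Since \<open>\<sigma>\<close> is central and self-adjoint,
  \<open>(\<sigma>m)(\<sigma>m)\<^sup>\<star> = \<tau>mm\<^sup>\<star> = P(m)P(m)\<^sup>\<star>\<close>, so \<open>P(m) \<mapsto> \<sigma>m\<close> is well defined and isometric;
  it extends by continuity and is a bimodule map because \<open>\<sigma>\<close> commutes with \<open>B\<close>. The equality of
  the two ideals follows from \<open>\<tau>mn\<^sup>\<star> = P(mP(n\<^sup>\<star>))\<close> and, conversely, by writing \<open>P(m) = cn\<close> with
  \<open>c\<close> in the closure of \<open>\<tau>R(M)\<close>, which contains \<open>P(m)P(m)\<^sup>\<star>\<close>.

  Existence and uniqueness of \<open>\<sigma>\<close> and the factorization \<open>m = an\<close> need some C*-theory. It is done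
  without spectra: an element is positive if it is self-adjoint and at distance at most \<open>c\<close> from
  \<open>c1\<close> for some \<open>c \<ge> 0\<close>, and square roots come from an iteration.\<close>

text \<open>Two obstacles shape the C*-part. In \<open>mult_positive\<close> positivity means having
  the form \<open>v\<^sup>\<star> * v\<close>, and the general theorem that all such elements
  satisfy the norm criterion is avoided. Two special cases replace it: \<open>v\<close> commuting
  with \<open>v\<^sup>\<star> * v\<close>, which covers \<tau> because \<tau> is central, and the
  impossibility of \<open>v\<^sup>\<star> * v = - (q * q)\<close> with self-adjoint \<open>q\<close>
  unless \<open>v = 0\<close>, which yields uniqueness of the root. The second obstacle is the unit.
  The algebra \<open>'a\<close> need not have one and the multiplier algebra is not a type, while
  the iteration starts from the 1 of a type. Both are embedded in one unital algebra, with images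
  that need not contain its 1. Roots are brought back by the fact that the root of \<open>t\<close>
  lies in every closed subalgebra containing \<open>t\<close>, even one without unit. The same fact,
  applied to commutants, supplies the commutation relations between roots.\<close>

lemma norm_adj [simp]: "norm (x\<^sup>\<star>) = norm (x :: 'a::cstar_algebra)"
proof -
  have *: "norm y \<le> norm (y\<^sup>\<star>)" for y :: 'a
  proof (cases "y = 0")
    case False
    have "norm y * norm y \<le> norm (y\<^sup>\<star>) * norm y"
      using cstar_identity[of y] norm_mult_ineq[of "y\<^sup>\<star>" y] by (simp add: power2_eq_square)
    then show ?thesis using False by simp
  qed simp
  from *[of x] *[of "x\<^sup>\<star>"] show ?thesis by (simp add: adj_adj)
qed

lemma norm_mult_adj: "norm (x * x\<^sup>\<star>) = (norm (x :: 'a::cstar_algebra))\<^sup>2"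
  using cstar_identity[of "x\<^sup>\<star>"] by (simp add: adj_adj)

lemma adj_scaleR: "(r *\<^sub>R x)\<^sup>\<star> = r *\<^sub>R (x :: 'a::cstar_algebra)\<^sup>\<star>"
  by (metis adj_scaleC complex_cnj_complex_of_real scaleC_of_real)

lemma bounded_linear_adj: "bounded_linear (\<lambda>x :: 'a::cstar_algebra. x\<^sup>\<star>)"
  by (rule bounded_linear_intro[where K = 1]) (simp_all add: adj_add adj_scaleR)

lemmas adj_diff = linear_diff[OF bounded_linear.linear[OF bounded_linear_adj]]
lemmas adj_zero [simp] = linear_0[OF bounded_linear.linear[OF bounded_linear_adj]]
lemmas tendsto_adj = bounded_linear.tendsto[OF bounded_linear_adj]

lemma bounded_linear_scaleC: "bounded_linear (\<lambda>x :: 'a::cstar_algebra. c *\<^sub>C x)"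
proof (rule bounded_linear_intro[where K = "cmod c"])
  show "c *\<^sub>C (r *\<^sub>R x) = r *\<^sub>R (c *\<^sub>C x)" for r and x :: 'a
    by (simp add: scaleC_of_real[symmetric] scaleC_scaleC mult.commute)
qed (simp_all add: scaleC_add_right norm_scaleC mult.commute)

lemmas tendsto_scaleC = bounded_linear.tendsto[OF bounded_linear_scaleC]
lemmas scaleC_diff_right = linear_diff[OF bounded_linear.linear[OF bounded_linear_scaleC]]

lemma scaleC_one [simp]: "1 *\<^sub>C x = (x :: 'a::cstar_algebra)"
  using scaleC_of_real[of 1 x] by simp

lemma csubspace_imp_subspace: "csubspace (S :: 'a::cstar_algebra set) \<Longrightarrow> subspace S"
  by (metis cvec.subspace_def scaleC_of_real subspace_def)

section \<open>Square roots and positivity in unital C*-algebras\<close>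

text \<open>Neither a unit nor closure under adjoints is required, so that the notion covers the
  commutant of an arbitrary element, the image of a subalgebra under \<open>left_mult\<close>, and
  \<open>concentrated_at I\<close>.\<close>

definition closed_subalgebra :: "'a::real_normed_algebra set \<Rightarrow> bool" where
  "closed_subalgebra C \<longleftrightarrow> closed C \<and> subspace C \<and> (\<forall>x\<in>C. \<forall>y\<in>C. x * y \<in> C)"

lemma closed_subalgebra_commutant:
  "closed_subalgebra {x. v * x = x * (v :: 'a::real_normed_algebra)}"
proof -
  have "closed {x. v * x = x * v}"
    by (intro closed_Collect_eq continuous_intros)
  moreover have "v * (x * y) = x * y * v" if "v * x = x * v" "v * y = y * v" for x y
    using that by (metis mult.assoc)
  ultimately show ?thesis
    by (auto simp: closed_subalgebra_def subspace_def algebra_simps)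
qed

lemma adj_one [simp]: "(1 :: 'a::{cstar_algebra,monoid_mult})\<^sup>\<star> = 1"
  by (metis adj_adj adj_mult mult_1_left mult_1_right)

text \<open>Only an inequality, because the sort does not exclude the zero algebra.\<close>

lemma norm_one_le: "norm (1 :: 'a::{cstar_algebra,monoid_mult}) \<le> 1"
proof -
  have "(norm (1::'a))\<^sup>2 = norm (1::'a)"
    using cstar_identity[of "1::'a"] by simp
  then show ?thesis by (simp add: power2_eq_square) auto
qed

lemma norm_power_le:
  "norm x \<le> 1 \<Longrightarrow> norm ((x :: 'a::{cstar_algebra,monoid_mult}) ^ n) \<le> 1"
proof (induction n)
  case (Suc n)
  have "norm (x * x ^ n) \<le> norm x * norm (x ^ n)" by (rule norm_mult_ineq)
  also have "\<dots> \<le> 1 * 1" using Suc by (intro mult_mono) auto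
  finally show ?case by simp
qed (simp add: norm_one_le)

lemma adj_power: "((x :: 'a::{cstar_algebra,monoid_mult}) ^ n)\<^sup>\<star> = x\<^sup>\<star> ^ n"
  by (induction n) (simp_all add: adj_mult power_commutes)

lemma norm_square_sa: "x\<^sup>\<star> = x \<Longrightarrow> norm (x * x) = (norm (x :: 'a::cstar_algebra))\<^sup>2"
  by (metis cstar_identity)

section \<open>Square roots by iteration\<close>

text \<open>A fixed point \<open>w\<close> satisfies \<open>w * w = t\<close>. Unlike Newton's
  method the step needs no inverse, so all iterates are polynomials in \<open>t\<close>. The type
  also admits the scalar iteration over the reals, which serves as majorant.\<close>

primrec sqrt_iter :: "'a::{real_normed_algebra,monoid_mult} \<Rightarrow> nat \<Rightarrow> 'a" where
  "sqrt_iter t 0 = 1"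
| "sqrt_iter t (Suc n) = sqrt_iter t n + (1/2) *\<^sub>R (t - sqrt_iter t n * sqrt_iter t n)"

lemma sqrt_iter_zero_bounds: "0 < sqrt_iter (0::real) n \<and> sqrt_iter (0::real) n \<le> 1"
proof (induction n)
  case (Suc n)
  define r where "r = sqrt_iter (0::real) n"
  have "r * r \<le> 1 * r" using Suc unfolding r_def by (intro mult_right_mono) auto
  moreover have "0 < r" "r \<le> 1" using Suc unfolding r_def by auto
  ultimately have "0 < r - r * r / 2" "r - r * r / 2 \<le> 1"
    using zero_le_square[of r] by linarith+
  then show ?case by (simp add: r_def[symmetric])
qed simp

lemma sqrt_iter_zero_decseq: "decseq (sqrt_iter (0::real))"
  by (rule decseq_SucI) simp

text \<open>This limit is used twice in \<open>ex_sqrt\<close>: it makes the majorant of the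
  increments small, and it removes the constant terms of the iterates in the limit.\<close>

lemma sqrt_iter_zero_tendsto: "sqrt_iter (0::real) \<longlonglongrightarrow> 0"
proof -
  obtain L where L: "sqrt_iter (0::real) \<longlonglongrightarrow> L"
    using decseq_convergent[OF sqrt_iter_zero_decseq, of 0] sqrt_iter_zero_bounds less_imp_le
    by metis
  have "(\<lambda>n. sqrt_iter (0::real) (Suc n)) \<longlonglongrightarrow> L + (1/2) *\<^sub>R (0 - L * L)"
    unfolding sqrt_iter.simps by (intro tendsto_intros L)
  moreover have "(\<lambda>n. sqrt_iter (0::real) (Suc n)) \<longlonglongrightarrow> L"
    by (rule LIMSEQ_Suc[OF L])
  ultimately have "L = L + (1/2) *\<^sub>R (0 - L * L)" using LIMSEQ_unique by blast
  then have "L = 0" by simp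
  then show ?thesis using L by simp
qed

text \<open>In terms of \<open>y = 1 - w\<close> the recursion reads \<open>y' = ((1 - t) + y\<^sup>2) / 2\<close>, a
  polynomial in \<open>1 - t\<close> with nonnegative coefficients; hence the scalar iteration at \<open>t = 0\<close>
  dominates the one at \<open>t\<close> as soon as \<open>norm (1 - t) \<le> 1\<close>.\<close>

lemma sqrt_iter_bounds:
  fixes t :: "'a::{cstar_algebra,monoid_mult}"
  assumes "norm (1 - t) \<le> 1"
  shows "norm (1 - sqrt_iter t n) \<le> 1 - sqrt_iter 0 n"
    and "norm (sqrt_iter t (Suc n) - sqrt_iter t n) \<le> sqrt_iter 0 n - sqrt_iter 0 (Suc n)"
proof -
  define y where "y n = 1 - sqrt_iter t n" for n
  define a where "a n = 1 - sqrt_iter (0::real) n" for n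
  have y_Suc: "y (Suc n) = (1/2) *\<^sub>R ((1 - t) + y n * y n)" for n
    by (simp add: y_def algebra_simps) (simp flip: scaleR_add_left)
  have a_Suc: "a (Suc n) = (1 + a n * a n) / 2" for n
    by (simp add: a_def field_simps)
  have a0: "0 \<le> a n" for n using sqrt_iter_zero_bounds[of n] by (simp add: a_def)
  have yb: "norm (y n) \<le> a n" for n
  proof (induction n)
    case (Suc n)
    have "norm (y n * y n) \<le> a n * a n"
      using norm_mult_ineq[of "y n" "y n"] mult_mono[OF Suc Suc a0] by simp
    then show ?case unfolding y_Suc a_Suc
      using norm_triangle_ineq[of "1 - t" "y n * y n"] assms by simp
  qed (simp add: y_def a_def)
  have d: "norm (y (Suc n) - y n) \<le> a (Suc n) - a n" for n
  proof (induction n)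
    case 0
    then show ?case using assms by (simp add: y_Suc a_Suc) (simp add: y_def a_def)
  next
    case (Suc n)
    let ?p = "y (Suc n)" and ?q = "y n"
    \<comment> \<open>This form of the difference of squares needs no commutation of consecutive
      iterates.\<close>
    have "y (Suc (Suc n)) - ?p = (1/2) *\<^sub>R (?p * (?p - ?q) + (?p - ?q) * ?q)"
      unfolding y_Suc[of "Suc n"] y_Suc[of n] by (simp add: algebra_simps)
    then have "norm (y (Suc (Suc n)) - ?p) \<le> (norm (?p * (?p - ?q)) + norm ((?p - ?q) * ?q)) / 2"
      using norm_triangle_ineq[of "?p * (?p - ?q)" "(?p - ?q) * ?q"] by simp
    also have "norm (?p * (?p - ?q)) \<le> a (Suc n) * (a (Suc n) - a n)"
      using norm_mult_ineq[of ?p "?p - ?q"] mult_mono[OF yb[of "Suc n"] Suc a0] by simp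
    also have "norm ((?p - ?q) * ?q) \<le> (a (Suc n) - a n) * a n"
      using norm_mult_ineq[of "?p - ?q" ?q] mult_mono[OF Suc yb[of n]] Suc
      by (smt (verit) norm_ge_zero)
    also have "(a (Suc n) * (a (Suc n) - a n) + (a (Suc n) - a n) * a n) / 2
        = a (Suc (Suc n)) - a (Suc n)"
      unfolding a_Suc[of "Suc n"] a_Suc[of n] by (simp add: field_simps)
    finally show ?case by simp
  qed
  show "norm (1 - sqrt_iter t n) \<le> 1 - sqrt_iter 0 n"
    using yb by (simp add: y_def a_def)
  show "norm (sqrt_iter t (Suc n) - sqrt_iter t n) \<le> sqrt_iter 0 n - sqrt_iter 0 (Suc n)"
    using d[of n] unfolding y_def a_def
    by (simp only: diff_diff_eq2 norm_minus_commute) (simp add: algebra_simps norm_minus_commute)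
qed

text \<open>The increments are dominated by those of a convergent scalar sequence, so the iterates
  converge, necessarily to a fixed point. For self-adjoint \<open>t\<close> the norm hypothesis says
  that the spectrum lies between 0 and 2.\<close>

lemma ex_sqrt:
  fixes t :: "'a::{cstar_algebra,monoid_mult}"
  assumes "norm (1 - t) \<le> 1" and "t\<^sup>\<star> = t"
  obtains s where "s * s = t" "s\<^sup>\<star> = s" "norm (1 - s) \<le> 1"
    "\<And>C. closed_subalgebra C \<Longrightarrow> t \<in> C \<Longrightarrow> s \<in> C"
proof -
  let ?w = "sqrt_iter t" and ?r = "sqrt_iter (0::real)"
  have mono: "norm (?w m - ?w n) \<le> ?r n - ?r m" if "n \<le> m" for n m
    using that
  proof (induction m rule: dec_induct)
    case (step m)
    have "?w (Suc m) - ?w n = (?w (Suc m) - ?w m) + (?w m - ?w n)"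
      by (simp del: sqrt_iter.simps)
    then have "norm (?w (Suc m) - ?w n) \<le> norm (?w (Suc m) - ?w m) + norm (?w m - ?w n)"
      by (metis norm_triangle_ineq)
    then show ?case
      using step.IH sqrt_iter_bounds(2)[OF assms(1), of m] by linarith
  qed simp
  have "Cauchy ?w"
  proof (rule metric_CauchyI)
    fix e :: real assume "0 < e"
    then obtain N where N: "\<And>n. n \<ge> N \<Longrightarrow> ?r n < e"
      using order_tendstoD(2)[OF sqrt_iter_zero_tendsto] unfolding eventually_sequentially by blast
    have "norm (?w m - ?w n) < e" if "m \<ge> N" "n > m" for m n
      using mono[of m n] N[OF that(1)] sqrt_iter_zero_bounds[of n] that
      by (simp add: norm_minus_commute)
    then show "\<exists>M. \<forall>m\<ge>M. \<forall>n\<ge>M. dist (?w m) (?w n) < e"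
      unfolding dist_norm using \<open>0 < e\<close> norm_minus_commute linorder_neqE_nat by (metis diff_self norm_zero)
  qed
  then obtain s where s: "?w \<longlonglongrightarrow> s"
    using Cauchy_convergent_iff convergent_def by blast
  have "(\<lambda>n. ?w (Suc n)) \<longlonglongrightarrow> s + (1/2) *\<^sub>R (t - s * s)"
    unfolding sqrt_iter.simps by (intro tendsto_intros s)
  then have "s = s + (1/2) *\<^sub>R (t - s * s)"
    using LIMSEQ_Suc[OF s] LIMSEQ_unique by blast
  then have "s * s = t" by simp
  moreover have "s\<^sup>\<star> = s"
  proof -
    have "(?w n)\<^sup>\<star> = ?w n" for n
      by (induction n) (simp_all add: adj_add adj_scaleR adj_diff adj_mult assms(2))
    then show ?thesis using tendsto_adj[OF s] s LIMSEQ_unique by auto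
  qed
  moreover have "norm (1 - s) \<le> 1"
  proof (rule Lim_norm_ubound)
    show "(\<lambda>n. 1 - ?w n) \<longlonglongrightarrow> 1 - s" by (intro tendsto_intros s)
    have "norm (1 - ?w n) \<le> 1" for n
      using sqrt_iter_bounds(1)[OF assms(1), of n] sqrt_iter_zero_bounds[of n] by linarith
    then show "\<forall>\<^sub>F n in sequentially. norm (1 - ?w n) \<le> 1" by simp
  qed simp
  moreover have "s \<in> C" if C: "closed_subalgebra C" and "t \<in> C" for C
  proof -
    have sub: "subspace C" and mult: "\<And>x y. x \<in> C \<Longrightarrow> y \<in> C \<Longrightarrow> x * y \<in> C" and "closed C"
      using C by (auto simp: closed_subalgebra_def)
    \<comment> \<open>\<open>?r n\<close> is the constant term of \<open>?w n\<close> as a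
      polynomial in \<open>t\<close>. What remains has no constant term, so it lies in
      \<open>C\<close> even if 1 does not.\<close>
    have "?w n - ?r n *\<^sub>R 1 \<in> C" for n
    proof (induction n)
      case 0
      then show ?case using subspace_0[OF sub] by simp
    next
      case (Suc n)
      define b where "b = ?w n - ?r n *\<^sub>R 1"
      have w: "?w n = b + ?r n *\<^sub>R 1" by (simp add: b_def)
      have "(b + c *\<^sub>R 1) * (b + c *\<^sub>R 1) = b * b + (2 * c) *\<^sub>R b + (c * c) *\<^sub>R 1" for c
        by (simp only: distrib_left distrib_right mult_scaleR_left mult_scaleR_right mult_1_left
            mult_1_right scaleR_scaleR mult_2 scaleR_left_distrib scaleR_right_distrib add.assoc)
      from this[of "?r n"]
      have sq: "?w n * ?w n = b * b + (2 * ?r n) *\<^sub>R b + (?r n * ?r n) *\<^sub>R 1"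
        unfolding w .
      have "?w (Suc n) - ?r (Suc n) *\<^sub>R 1 = b + (1/2) *\<^sub>R (t - b * b) - ?r n *\<^sub>R b"
        unfolding sqrt_iter.simps sq unfolding w
        by (simp add: scaleR_left_distrib scaleR_left_diff_distrib scaleR_diff_right scaleR_add_right)
      moreover have "b \<in> C" using Suc by (simp add: b_def)
      ultimately show ?case
        using \<open>t \<in> C\<close> mult by (simp add: subspace_add subspace_diff subspace_scale sub)
    qed
    moreover have "(\<lambda>n. ?w n - ?r n *\<^sub>R 1) \<longlonglongrightarrow> s - 0 *\<^sub>R 1"
      by (intro tendsto_intros s sqrt_iter_zero_tendsto)
    ultimately have "s - 0 *\<^sub>R 1 \<in> C" by (rule closed_sequentially[OF \<open>closed C\<close>])
    then show ?thesis by simp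
  qed
  ultimately show ?thesis by (rule that)
qed

text \<open>The norm condition is equivalent to having nonnegative spectrum; it makes closure under
  addition immediate.\<close>

definition pos :: "'a::{cstar_algebra,monoid_mult} \<Rightarrow> bool" where
  "pos x \<longleftrightarrow> x\<^sup>\<star> = x \<and> (\<exists>c\<ge>0. norm (c *\<^sub>R 1 - x) \<le> c)"

lemma pos_sa: "pos x \<Longrightarrow> x\<^sup>\<star> = x"
  by (simp add: pos_def)

lemma pos_zero [simp]: "pos 0"
  by (auto simp: pos_def)

lemma pos_one [simp]: "pos 1"
  unfolding pos_def by (auto intro!: exI[of _ 1])

lemma pos_add: assumes "pos x" "pos y" shows "pos (x + y)"
proof -
  obtain c d where c: "0 \<le> c" "norm (c *\<^sub>R 1 - x) \<le> c" and d: "0 \<le> d" "norm (d *\<^sub>R 1 - y) \<le> d"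
    using assms by (auto simp: pos_def)
  have "(c + d) *\<^sub>R 1 - (x + y) = (c *\<^sub>R 1 - x) + (d *\<^sub>R 1 - y)"
    by (simp add: algebra_simps)
  then have "norm ((c + d) *\<^sub>R 1 - (x + y)) \<le> c + d"
    using norm_triangle_mono[OF c(2) d(2)] by (simp only:)
  then show ?thesis
    using assms c d by (auto simp: pos_def adj_add intro!: exI[of _ "c + d"])
qed

lemma pos_sum: "finite A \<Longrightarrow> (\<And>i. i \<in> A \<Longrightarrow> pos (f i)) \<Longrightarrow> pos (sum f A)"
  by (induction rule: finite_induct) (auto intro: pos_add)

lemma pos_scaleR: assumes "pos x" "0 \<le> r" shows "pos (r *\<^sub>R x)"
proof -
  obtain c where c: "0 \<le> c" "norm (c *\<^sub>R 1 - x) \<le> c"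
    using assms by (auto simp: pos_def)
  have "norm ((r * c) *\<^sub>R 1 - r *\<^sub>R x) = r * norm (c *\<^sub>R 1 - x)"
    using assms(2) by (simp flip: scaleR_scaleR scaleR_diff_right)
  then show ?thesis
    using assms c by (auto simp: pos_def adj_scaleR mult_left_mono intro!: exI[of _ "r * c"])
qed

text \<open>Rescales \<open>x\<close> into the range of \<open>ex_sqrt\<close>. The value
  \<open>c = 0\<close> in \<open>pos\<close> forces \<open>x = 0\<close>, where any positive
  \<open>c\<close> will do.\<close>

lemma pos_obtain_scale:
  assumes "pos x"
  obtains c where "c > 0" "norm (1 - (1 / c) *\<^sub>R x) \<le> 1"
proof -
  obtain c where c: "0 \<le> c" "norm (c *\<^sub>R 1 - x) \<le> c"
    using assms unfolding pos_def by blast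
  show ?thesis
  proof (cases "c = 0")
    case True
    with c have "x = 0" by simp
    then show ?thesis using that[of 1] norm_one_le by simp
  next
    case False
    have "1 - (1 / c) *\<^sub>R x = (1 / c) *\<^sub>R (c *\<^sub>R 1 - x)"
      using False by (simp add: scaleR_diff_right)
    then have "norm (1 - (1 / c) *\<^sub>R x) = (1 / c) * norm (c *\<^sub>R 1 - x)"
      using c by simp
    also have "\<dots> \<le> (1 / c) * c" using c by (intro mult_left_mono) auto
    finally show ?thesis using that[of c] c False by simp
  qed
qed

lemma pos_obtain_sqrt:
  assumes "pos x"
  obtains s where "pos s" "s * s = x"
    "\<And>C. closed_subalgebra C \<Longrightarrow> x \<in> C \<Longrightarrow> s \<in> C"
proof -
  obtain c where c: "c > 0" "norm (1 - (1 / c) *\<^sub>R x) \<le> 1"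
    using pos_obtain_scale[OF assms] .
  obtain s where s: "s * s = (1 / c) *\<^sub>R x" "s\<^sup>\<star> = s" "norm (1 - s) \<le> 1"
    and C: "\<And>C. closed_subalgebra C \<Longrightarrow> (1 / c) *\<^sub>R x \<in> C \<Longrightarrow> s \<in> C"
    using ex_sqrt[OF c(2)] pos_sa[OF assms] by (auto simp: adj_scaleR)
  have "pos s" using s by (auto simp: pos_def intro!: exI[of _ 1])
  then have "pos (sqrt c *\<^sub>R s)" using c by (intro pos_scaleR) auto
  moreover have "sqrt c *\<^sub>R s * (sqrt c *\<^sub>R s) = x" using c s by simp
  moreover have "sqrt c *\<^sub>R s \<in> C" if "closed_subalgebra C" "x \<in> C" for C
    using C[OF that(1)] that by (auto simp: closed_subalgebra_def subspace_scale)
  ultimately show ?thesis by (rule that)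
qed

text \<open>\<open>h\<close> is the real part of the normal element
  \<open>u = h + \<i> *\<^sub>C k\<close>, hence has at most its norm, and
  \<open>h * h + k * k\<close> is \<open>u\<^sup>\<star> * u\<close>.\<close>

lemma norm_sum_squares_ge:
  fixes h k :: "'a::cstar_algebra"
  assumes "h\<^sup>\<star> = h" "k\<^sup>\<star> = k" "h * k = k * h"
  shows "norm (h * h) \<le> norm (h * h + k * k)"
proof -
  define u where "u = h + \<i> *\<^sub>C k"
  have ua: "u\<^sup>\<star> = h - \<i> *\<^sub>C k"
    using assms scaleC_add_left[of "-\<i>" \<i> k]
    by (simp add: u_def adj_add adj_scaleC eq_neg_iff_add_eq_0)
  have "(h - \<i> *\<^sub>C k) * (h + \<i> *\<^sub>C k) = h * h + k * k"
    using assms(3)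
    by (simp add: algebra_simps mult_scaleC_left mult_scaleC_right scaleC_scaleC)
  then have "(norm u)\<^sup>2 = norm (h * h + k * k)"
    using cstar_identity[of u] unfolding ua by (simp add: u_def)
  moreover have "norm h \<le> norm u"
  proof -
    have "2 *\<^sub>R h = u + u\<^sup>\<star>" unfolding ua by (simp add: u_def scaleR_2)
    then have "2 * norm h \<le> norm u + norm (u\<^sup>\<star>)"
      by (metis norm_triangle_ineq norm_scaleR abs_numeral)
    then show ?thesis by simp
  qed
  ultimately show ?thesis using assms(1) by (metis norm_square_sa norm_ge_zero power_mono)
qed

text \<open>After scaling to a \<open>g\<close> of norm 1, the root \<open>y\<close> of
  \<open>1 - g * g\<close> commutes with \<open>g\<close>, and \<open>norm_sum_squares_ge\<close>
  compares \<open>y * y\<close> with \<open>y * y + g * g = 1\<close>. So \<open>g * g\<close> is at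
  distance at most 1 from 1.\<close>

lemma pos_square: assumes "h\<^sup>\<star> = h" shows "pos (h * h)"
proof (cases "h = 0")
  case False
  define g where "g = (1 / norm h) *\<^sub>R h"
  have g: "g\<^sup>\<star> = g" "norm (g * g) \<le> 1" "h * h = (norm h)\<^sup>2 *\<^sub>R (g * g)"
    using False assms
    by (simp_all add: g_def adj_scaleR norm_square_sa power2_eq_square)
  have "norm (1 - (1 - g * g)) \<le> 1" "(1 - g * g)\<^sup>\<star> = 1 - g * g"
    using g by (simp_all add: adj_diff adj_mult)
  then obtain y where y: "y * y = 1 - g * g" "y\<^sup>\<star> = y"
    "\<And>C. closed_subalgebra C \<Longrightarrow> 1 - g * g \<in> C \<Longrightarrow> y \<in> C"
    using ex_sqrt by blast
  have "y \<in> {x. g * x = x * g}"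
    by (rule y(3)[OF closed_subalgebra_commutant]) (simp add: algebra_simps)
  then have "norm (1 - g * g) \<le> norm (1 :: 'a)"
    using norm_sum_squares_ge[of y g] y g(1) by simp
  then have "norm (1 *\<^sub>R 1 - g * g) \<le> 1" using norm_one_le[where 'a = 'a] by simp
  then have "pos (g * g)"
    unfolding pos_def using g(1) by (metis adj_mult zero_le_one)
  then show ?thesis unfolding g(3) by (intro pos_scaleR) auto
qed simp

text \<open>The root of \<open>x\<close> inherits commutation with \<open>y\<close>; then the root
  of \<open>y\<close> inherits commutation with the root of \<open>x\<close>.\<close>

lemma commuting_sqrts:
  assumes "pos x" "pos y" "x * y = y * x"
  obtains h k where "h\<^sup>\<star> = h" "k\<^sup>\<star> = k" "x = h * h" "y = k * k" "h * k = k * h"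
proof -
  obtain h where h: "pos h" "h * h = x" "\<And>C. closed_subalgebra C \<Longrightarrow> x \<in> C \<Longrightarrow> h \<in> C"
    using pos_obtain_sqrt[OF assms(1)] by blast
  obtain k where k: "pos k" "k * k = y" "\<And>C. closed_subalgebra C \<Longrightarrow> y \<in> C \<Longrightarrow> k \<in> C"
    using pos_obtain_sqrt[OF assms(2)] by blast
  have "h \<in> {x. y * x = x * y}"
    using h(3)[OF closed_subalgebra_commutant] assms(3) by simp
  then have "k \<in> {x. h * x = x * h}"
    using k(3)[OF closed_subalgebra_commutant] by simp
  then have "h * k = k * h" by simp
  then show ?thesis
    by (rule that[OF pos_sa[OF h(1)] pos_sa[OF k(1)] h(2)[symmetric] k(2)[symmetric]])
qed

lemma pos_mult: assumes "pos x" "pos y" "x * y = y * x" shows "pos (x * y)"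
proof -
  obtain h k where hk: "h\<^sup>\<star> = h" "k\<^sup>\<star> = k" "x = h * h" "y = k * k" "h * k = k * h"
    using commuting_sqrts[OF assms] .
  have "x * y = h * k * (h * k)" using hk by (metis mult.assoc)
  moreover have "(h * k)\<^sup>\<star> = h * k" using hk by (simp add: adj_mult)
  ultimately show ?thesis by (metis pos_square)
qed

lemma pos_power: "pos x \<Longrightarrow> pos (x ^ n)"
  by (induction n) (auto intro!: pos_mult simp: power_commutes)

lemma pos_norm_mono: assumes "pos x" "pos y" "x * y = y * x" shows "norm x \<le> norm (x + y)"
  using commuting_sqrts[OF assms] norm_sum_squares_ge by metis

section \<open>Power estimates in place of functional calculus\<close>

lemma commute_power: "x * y = y * x \<Longrightarrow> x * y ^ n = y ^ n * (x :: 'a::{cstar_algebra,monoid_mult})"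
  by (induction n) (simp_all, metis mult.assoc)

lemma one_minus_power: "1 - y ^ n = (1 - y) * (\<Sum>i<n. y ^ i)" for y :: "'a::{cstar_algebra,monoid_mult}"
  by (induction n) (simp_all add: algebra_simps)

text \<open>The terms \<open>s * (1 - s) ^ j\<close> decrease with \<open>j\<close>, so
  \<open>n + 1\<close> times the last is at most their sum over \<open>j \<le> n\<close>, a
  geometric sum equal to \<open>1 - (1 - s) ^ (n + 1)\<close>. The comparisons go through
  \<open>pos_norm_mono\<close>, as all elements are polynomials in \<open>s\<close>.\<close>

lemma norm_mult_power_le:
  assumes "pos s" "pos (1 - s)"
  shows "norm (s * (1 - s) ^ n) \<le> 1 / (real n + 1)"
proof -
  let ?p = "1 - s"
  let ?f = "\<lambda>j. s * ?p ^ j"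
  have comm: "s * ?p ^ j = ?p ^ j * s" for j
    by (rule commute_power) (simp add: algebra_simps)
  have pc: "?p ^ i * ?p ^ j = ?p ^ j * ?p ^ i" for i j
    by (metis power_add add.commute)
  have fpos: "pos (?f j)" for j
    using assms comm by (intro pos_mult pos_power) auto
  have one_pos: "pos (1 - ?p ^ k)" for k
    unfolding one_minus_power using assms comm
    by (intro pos_mult pos_sum pos_power) (auto simp: sum_distrib_left sum_distrib_right)
  have diff: "?f j - ?f n = ?f j * (1 - ?p ^ (n - j))" if "j \<le> n" for j
    using that by (simp add: algebra_simps mult.assoc flip: power_add)
  have fc: "?f j * ?p ^ i = ?p ^ i * ?f j" for i j
    by (metis comm mult.assoc pc)
  have ff: "?f j * ?f i = ?f i * ?f j" for i j
    by (metis comm mult.assoc pc)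
  have dpos: "pos (?f j - ?f n)" if "j \<le> n" for j
    unfolding diff[OF that]
    by (rule pos_mult[OF fpos one_pos]) (simp only: right_diff_distrib left_diff_distrib fc mult_1_left mult_1_right)
  let ?S = "\<Sum>j\<le>n. ?f j - ?f n"
  have eq: "(real n + 1) *\<^sub>R ?f n + ?S = 1 - ?p ^ Suc n"
    unfolding one_minus_power lessThan_Suc_atMost
    by (simp add: sum_subtractf sum_distrib_left scaleR_left_distrib sum_constant_scaleR)
  have "norm ((real n + 1) *\<^sub>R ?f n) \<le> norm ((real n + 1) *\<^sub>R ?f n + ?S)"
    using fpos dpos ff
    by (intro pos_norm_mono pos_scaleR pos_sum)
      (auto simp: sum_distrib_left sum_distrib_right right_diff_distrib left_diff_distrib
        scaleR_sum_right scaleR_diff_right)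
  also have "\<dots> = norm (1 - ?p ^ Suc n)" by (simp only: eq)
  also have "\<dots> \<le> norm ((1 - ?p ^ Suc n) + ?p ^ Suc n)"
    using one_pos[of "Suc n"] assms
    by (intro pos_norm_mono pos_power) (auto simp: right_diff_distrib left_diff_distrib)
  also have "\<dots> \<le> 1" using norm_one_le by (simp only: diff_add_cancel)
  finally have "(real n + 1) * norm (?f n) \<le> 1" by (simp only: norm_scaleR)
  then show ?thesis by (simp add: field_simps)
qed

text \<open>For self-adjoint \<open>x\<close> the C*-identity makes the norm multiplicative along
  the exponents \<open>2 ^ k\<close>, so a norm above 1 would force exponential growth.\<close>

lemma norm_le_one_if_power_growth:
  fixes x :: "'a::{cstar_algebra,monoid_mult}"
  assumes "x\<^sup>\<star> = x" "\<And>n. norm (x ^ n) \<le> 1 + real n * K"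
  shows "norm x \<le> 1"
proof (rule ccontr)
  assume "\<not> norm x \<le> 1"
  then have r: "norm x > 1" by simp
  have pow: "norm (x ^ (2 ^ k)) = norm x ^ (2 ^ k)" for k :: nat
  proof (induction k)
    case (Suc k)
    have "x ^ (2 ^ Suc k) = x ^ (2 ^ k) * x ^ (2 ^ k)" by (simp add: mult_2 flip: power_add)
    then have "norm (x ^ (2 ^ Suc k)) = (norm (x ^ (2 ^ k)))\<^sup>2"
      using assms(1) by (simp add: norm_square_sa adj_power)
    then show ?case by (simp add: Suc mult.commute flip: power_mult)
  qed simp
  have "(\<lambda>n. (1 + real n * K) / norm x ^ n) \<longlonglongrightarrow> 0"
  proof -
    have less: "norm (1 / norm x) < 1" using r by (simp add: divide_less_eq)
    have 1: "(\<lambda>n. real n * (1 / norm x) ^ n) \<longlonglongrightarrow> 0"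
      using less by (rule powser_times_n_limit_0)
    have 2: "(\<lambda>n. (1 / norm x) ^ n) \<longlonglongrightarrow> 0"
      using less by (rule LIMSEQ_power_zero)
    have "(\<lambda>n. (1 / norm x) ^ n + real n * (1 / norm x) ^ n * K) \<longlonglongrightarrow> 0 + 0 * K"
      by (intro tendsto_intros 1 2)
    then show ?thesis by (simp add: field_simps add_divide_distrib power_one_over)
  qed
  then have "\<forall>\<^sub>F n in sequentially. (1 + real n * K) / norm x ^ n < 1"
    by (rule order_tendstoD(2)) simp
  then obtain N where N: "\<forall>n\<ge>N. (1 + real n * K) / norm x ^ n < 1"
    unfolding eventually_sequentially ..
  have "N \<le> 2 ^ N" by simp
  moreover have "0 < norm x ^ (2 ^ N)" using r by (intro zero_less_power) linarith
  ultimately have "1 + real (2 ^ N) * K < norm x ^ (2 ^ N)"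
    using N[rule_format, of "2 ^ N"] divide_less_eq_1_pos by blast
  with assms(2)[of "2 ^ N"] pow[of N] show False by simp
qed

section \<open>Elements of the form \<open>v\<^sup>\<star> * v\<close>\<close>

text \<open>Up to real factors \<open>h\<close> and \<open>k\<close> are the real and imaginary
  parts of \<open>y\<close>; the squares of \<open>y\<close> and \<open>y\<^sup>\<star>\<close>
  cancel in \<open>h * h + k * k\<close>.\<close>

lemma pos_adj_mult_self_add: "pos (y\<^sup>\<star> * y + y * y\<^sup>\<star>)"
proof -
  define h where "h = y + y\<^sup>\<star>"
  define k where "k = \<i> *\<^sub>C (y - y\<^sup>\<star>)"
  have "h\<^sup>\<star> = h" by (simp add: h_def adj_add adj_adj)
  moreover have "k\<^sup>\<star> = k"
  proof -
    have "k\<^sup>\<star> = (-1 * \<i>) *\<^sub>C (y\<^sup>\<star> - y)" by (simp add: k_def adj_scaleC adj_diff adj_adj)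
    also have "\<dots> = k" unfolding scaleC_scaleC[symmetric] by (simp add: k_def scaleC_diff_right)
    finally show ?thesis .
  qed
  moreover have "k * k = - ((y - y\<^sup>\<star>) * (y - y\<^sup>\<star>))"
    by (simp add: k_def mult_scaleC_left mult_scaleC_right scaleC_scaleC)
  then have "h * h + k * k = 2 *\<^sub>R (y\<^sup>\<star> * y + y * y\<^sup>\<star>)"
    by (simp add: h_def algebra_simps scaleR_2)
  then have "y\<^sup>\<star> * y + y * y\<^sup>\<star> = (1/2) *\<^sub>R (h * h + k * k)"
    by (simp only: scaleR_scaleR) simp
  ultimately show ?thesis by (metis pos_add pos_scaleR pos_square zero_le_divide_1_iff zero_le_numeral)
qed

lemma intertwine_power:
  "a * y = y * b \<Longrightarrow> a ^ n * y = y * (b :: 'a::{cstar_algebra,monoid_mult}) ^ n"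
  by (induction n) (simp_all, metis mult.assoc power_Suc power_commutes)

text \<open>With \<open>p = v\<^sup>\<star>v + vv\<^sup>\<star>\<close> one has \<open>zv = (p/2)v\<close> for \<open>z = v\<^sup>\<star>v\<close>, so
  that \<open>z(1 - z)\<^sup>n = v\<^sup>\<star>(1 - p/2)\<^sup>nv\<close> is bounded after rescaling; thus \<open>(1 - z)\<^sup>n\<close> grows at
  most linearly.\<close>

lemma pos_adj_mult_self_if_commute:
  assumes "z = v\<^sup>\<star> * v" "z * v = v * z"
  shows "pos z"
proof -
  have zsa: "z\<^sup>\<star> = z" by (simp add: assms(1) adj_mult adj_adj)
  define p where "p = (1/2) *\<^sub>R (v\<^sup>\<star> * v + v * v\<^sup>\<star>)"
  have "pos p" unfolding p_def by (intro pos_scaleR pos_adj_mult_self_add) simp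
  then obtain c where c: "c > 0" "norm (1 - (1 / c) *\<^sub>R p) \<le> 1"
    using pos_obtain_scale by blast
  let ?q = "1 - (1 / c) *\<^sub>R p" and ?y = "1 - (1 / c) *\<^sub>R z"
  \<comment> \<open>Each of the two summands in \<open>p\<close> contributes half of
    \<open>v * z\<close>: one by associativity, the other because \<open>z\<close> commutes with
    \<open>v\<close>.\<close>
  have "p * v = v * z"
  proof -
    have "v * v\<^sup>\<star> * v = v * z" by (simp add: assms(1) mult.assoc)
    then have "p * v = (1/2) *\<^sub>R (v * z + v * z)"
      using assms by (simp add: p_def distrib_right)
    then show ?thesis by (simp flip: scaleR_2)
  qed
  then have "?q * v = v * ?y" by (simp add: algebra_simps)
  then have pw: "?q ^ n * v = v * ?y ^ n" for n by (rule intertwine_power)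
  define K where "K = (norm v)\<^sup>2 / c"
  have K: "norm ((1 / c) *\<^sub>R z * ?y ^ n) \<le> K" for n
  proof -
    have "z * ?y ^ n = v\<^sup>\<star> * (?q ^ n * v)" by (simp add: pw assms(1) mult.assoc)
    also have "norm \<dots> \<le> norm (v\<^sup>\<star>) * (norm (?q ^ n) * norm v)"
      by (meson norm_mult_ineq order_trans mult_left_mono norm_ge_zero)
    also have "\<dots> \<le> norm (v\<^sup>\<star>) * (1 * norm v)"
      by (intro mult_left_mono mult_right_mono norm_power_le c) auto
    finally show ?thesis using c by (simp add: K_def power2_eq_square divide_right_mono)
  qed
  have "norm (?y ^ n) \<le> 1 + real n * K" for n
  proof (induction n)
    case (Suc n)
    have "?y ^ Suc n = ?y ^ n - (1 / c) *\<^sub>R z * ?y ^ n" by (simp add: algebra_simps)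
    then have "norm (?y ^ Suc n) \<le> norm (?y ^ n) + norm ((1 / c) *\<^sub>R z * ?y ^ n)"
      by (metis norm_triangle_ineq4)
    then show ?case using Suc K[of n] by (simp add: algebra_simps)
  qed (simp add: norm_one_le)
  then have "norm ?y \<le> 1"
    by (intro norm_le_one_if_power_growth) (auto simp: adj_diff adj_scaleR zsa)
  then have "pos ((1 / c) *\<^sub>R z)" using zsa by (auto simp: pos_def adj_scaleR intro!: exI[of _ 1])
  from pos_scaleR[OF this, of c] c show ?thesis by simp
qed

text \<open>If \<open>y\<^sup>\<star>y = -q\<^sup>2\<close> then \<open>yy\<^sup>\<star>\<close> is positive and \<open>q\<^sup>2(1 + q\<^sup>2)\<^sup>n\<close>
  is, up to sign and scaling, \<open>y\<^sup>\<star>(1 - yy\<^sup>\<star>)\<^sup>ny\<close>, hence bounded in \<open>n\<close>.\<close>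

lemma adj_mult_self_eq_minus_square:
  fixes y q :: "'a::{cstar_algebra,monoid_mult}"
  assumes "y\<^sup>\<star> * y = - (q * q)" "q\<^sup>\<star> = q"
  shows "y = 0"
proof -
  have "y * y\<^sup>\<star> = (y\<^sup>\<star> * y + y * y\<^sup>\<star>) + q * q" by (simp add: assms(1))
  then have "pos (y * y\<^sup>\<star>)" by (metis pos_add pos_adj_mult_self_add pos_square assms(2))
  then obtain c where c: "c > 0" "norm (1 - (1 / c) *\<^sub>R (y * y\<^sup>\<star>)) \<le> 1"
    using pos_obtain_scale by blast
  define r where "r = (1 / c) *\<^sub>R (q * q)"
  let ?p = "1 - (1 / c) *\<^sub>R (y * y\<^sup>\<star>)" and ?g = "1 + r"
  have r: "pos r" unfolding r_def using c by (intro pos_scaleR pos_square assms) auto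
  have g: "?g = 1 - (1 / c) *\<^sub>R (y\<^sup>\<star> * y)" by (simp add: r_def assms(1))
  have "?p * y = y * ?g" unfolding g by (simp add: algebra_simps)
  then have pw: "?p ^ n * y = y * ?g ^ n" for n by (rule intertwine_power)
  define K where "K = (norm y)\<^sup>2 / c"
  have K: "norm (r * ?g ^ n) \<le> K" for n
  proof -
    have "r * ?g ^ n = - ((1 / c) *\<^sub>R (y\<^sup>\<star> * (?p ^ n * y)))"
      by (simp add: pw r_def flip: mult.assoc) (simp add: assms(1) mult.assoc)
    moreover have "norm (y\<^sup>\<star> * (?p ^ n * y)) \<le> norm (y\<^sup>\<star>) * (norm (?p ^ n) * norm y)"
      by (meson norm_mult_ineq order_trans mult_left_mono norm_ge_zero)
    moreover have "\<dots> \<le> norm (y\<^sup>\<star>) * (1 * norm y)"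
      by (intro mult_left_mono mult_right_mono norm_power_le c) auto
    ultimately show ?thesis using c by (simp add: K_def power2_eq_square divide_right_mono)
  qed
  have rg: "r * ?g ^ n = ?g ^ n * r" for n
    by (rule commute_power) (simp add: algebra_simps)
  \<comment> \<open>Bernoulli's inequality for \<open>1 + r\<close>, expressed by
    \<open>pos\<close>.\<close>
  have bern: "pos (?g ^ n - 1 - real n *\<^sub>R r)" for n
  proof (induction n)
    case (Suc n)
    have "?g ^ Suc n - 1 - real (Suc n) *\<^sub>R r = ?g * (?g ^ n - 1 - real n *\<^sub>R r) + real n *\<^sub>R (r * r)"
      by (simp add: algebra_simps)
    moreover have "pos (?g * (?g ^ n - 1 - real n *\<^sub>R r))"
      using Suc r rg[of n] by (intro pos_mult pos_add) (auto simp: algebra_simps power_commutes)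
    ultimately show ?case using r by (auto intro!: pos_add pos_scaleR pos_mult)
  qed simp
  \<comment> \<open>Multiplied by \<open>r\<close>, Bernoulli's inequality bounds \<open>n\<close>
    times \<open>r * r\<close> by \<open>r * ?g ^ n\<close>, whose norm is at most \<open>K\<close>
    for every \<open>n\<close>; this forces \<open>r * r = 0\<close>.\<close>
  have "real n * norm (r * r) \<le> K" for n
  proof -
    let ?b = "?g ^ n - 1 - real n *\<^sub>R r"
    have rb: "r * ?b = ?b * r" using rg[of n] by (simp add: algebra_simps)
    have "norm (real n *\<^sub>R (r * r)) \<le> norm (real n *\<^sub>R (r * r) + (r * ?b + r))"
    proof (rule pos_norm_mono)
      show "pos (r * ?b + r)" using r bern rb by (intro pos_add pos_mult) auto
      have "r * (r * b + r) = (r * b + r) * r" if "r * b = b * r" for b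
        by (simp only: distrib_left distrib_right mult.assoc that[symmetric])
      moreover have "r * r * x = x * (r * r)" if "r * x = x * r" for x
        using that by (metis mult.assoc)
      ultimately have "r * r * (r * ?b + r) = (r * ?b + r) * (r * r)" using rb by simp
      then show "real n *\<^sub>R (r * r) * (r * ?b + r) = (r * ?b + r) * (real n *\<^sub>R (r * r))"
        by (simp only: mult_scaleR_left mult_scaleR_right)
    qed (use r in \<open>auto intro!: pos_scaleR pos_mult\<close>)
    also have "real n *\<^sub>R (r * r) + (r * ?b + r) = r * ?g ^ n" by (simp add: right_diff_distrib)
    finally show ?thesis using K[of n] by simp
  qed
  then have "norm (r * r) \<le> 0"
    by (metis reals_Archimedean3 not_le less_le_trans less_irrefl)
  then have "norm r = 0" using norm_square_sa[OF pos_sa[OF r]] by simp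
  then have "norm (q * q) = 0" using c by (simp add: r_def)
  then have "norm (y\<^sup>\<star> * y) = 0" by (simp add: assms(1))
  then show ?thesis by (simp add: cstar_identity)
qed

text \<open>The competitor \<rho> is not known to satisfy \<open>pos\<close>. It commutes with
  \<open>s * s\<close>, hence with \<open>s\<close> by the assumption on subalgebras, so
  \<open>d = s - \<rho>\<close> satisfies \<open>d * (s + \<rho>) = 0\<close> and
  \<open>d * \<rho> * d = - (d * s * d)\<close>. The left side is
  \<open>(v * d)\<^sup>\<star> * (v * d)\<close> and the right side is minus the square of the
  self-adjoint \<open>b * d\<close>. Thus both vanish, and their combination
  \<open>d * d * d\<close> is 0.\<close>

lemma pos_sqrt_unique:
  fixes s :: "'a::{cstar_algebra,monoid_mult}"
  assumes "pos s" and C: "\<And>C. closed_subalgebra C \<Longrightarrow> s * s \<in> C \<Longrightarrow> s \<in> C"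
    and \<rho>: "\<rho> = v\<^sup>\<star> * v" "\<rho> * \<rho> = s * s"
  shows "\<rho> = s"
proof -
  have \<rho>sa: "\<rho>\<^sup>\<star> = \<rho>" by (simp add: \<rho> adj_mult adj_adj)
  have "s \<in> {x. \<rho> * x = x * \<rho>}"
    by (rule C[OF closed_subalgebra_commutant]) (simp flip: \<rho>(2) add: mult.assoc)
  then have comm: "\<rho> * s = s * \<rho>" by simp
  obtain b where b: "pos b" "b * b = s" "\<And>C. closed_subalgebra C \<Longrightarrow> s \<in> C \<Longrightarrow> b \<in> C"
    using pos_obtain_sqrt[OF assms(1)] by blast
  define d where "d = s - \<rho>"
  have dsa: "d\<^sup>\<star> = d" using pos_sa[OF assms(1)] \<rho>sa by (simp add: d_def adj_diff)
  have "b \<in> {x. d * x = x * d}"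
    by (rule b(3)[OF closed_subalgebra_commutant]) (simp add: d_def algebra_simps comm)
  then have db: "d * b = b * d" by simp
  have "d * (s + \<rho>) = 0" using \<rho>(2) comm by (simp add: d_def algebra_simps)
  then have sum0: "d * \<rho> * d = - (d * s * d)"
    by (metis distrib_left distrib_right mult_zero_left eq_neg_iff_add_eq_0 add.commute)
  have "(v * d)\<^sup>\<star> * (v * d) = d * \<rho> * d" by (simp add: adj_mult dsa \<rho>(1) mult.assoc)
  also have "\<dots> = - (b * d * (b * d))" unfolding sum0 by (metis b(2) db mult.assoc)
  finally have vd: "v * d = 0"
    by (rule adj_mult_self_eq_minus_square) (simp add: adj_mult dsa pos_sa b db)
  then have "d * \<rho> * d = 0" by (simp add: \<rho>(1) mult.assoc)
  then have "d * s * d - d * \<rho> * d = 0" using sum0 by simp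
  then have "d * d * d = 0" by (simp add: d_def algebra_simps)
  then have "(d * d) * (d * d) = 0" by (metis mult.assoc mult_zero_left)
  then have "norm ((d * d) * (d * d)) = 0" by simp
  then have "d = 0" using dsa by (simp add: norm_square_sa adj_mult)
  then show ?thesis by (simp add: d_def)
qed

section \<open>The algebra of families of adjointable operators\<close>

text \<open>The multiplier algebra of \<open>I\<close> depends on the set \<open>I\<close>, so it is not the universe of a
  type. It embeds, however, in the product over all closed complex subspaces \<open>E\<close> of the algebras of
  adjointable operators on \<open>E\<close>, viewed as a Hilbert module with inner product \<open>x\<^sup>\<star>y\<close>, and
  this product is a unital C*-algebra. The algebra itself embeds as left multiplications at
  \<open>E = UNIV\<close>. Operators are extended by \<open>0\<close>.\<close>

definition in_module :: "'a::cstar_algebra set \<Rightarrow> 'a \<Rightarrow> bool" where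
  "in_module E x \<longleftrightarrow> closed E \<and> csubspace E \<and> x \<in> E"

lemma in_module_add: "in_module E x \<Longrightarrow> in_module E y \<Longrightarrow> in_module E (x + y)"
  and in_module_diff: "in_module E x \<Longrightarrow> in_module E y \<Longrightarrow> in_module E (x - y)"
  and in_module_scaleC: "in_module E x \<Longrightarrow> in_module E (c *\<^sub>C x)"
  and in_module_zero: "in_module E x \<Longrightarrow> in_module E 0"
  by (simp_all add: in_module_def cvec.subspace_add cvec.subspace_diff cvec.subspace_scale
      cvec.subspace_0)

lemma in_module_LIMSEQ:
  "(\<And>n. in_module E (X n)) \<Longrightarrow> X \<longlonglongrightarrow> x \<Longrightarrow> in_module E x"
  using closed_sequentially unfolding in_module_def by blast

text \<open>The inner product separates points: the vector to test with is
  \<open>u - v\<close>.\<close>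

lemma in_module_eqI:
  assumes "in_module E u" "in_module E v" "\<And>w. in_module E w \<Longrightarrow> u\<^sup>\<star> * w = v\<^sup>\<star> * w"
  shows "u = v"
proof -
  have "(u - v)\<^sup>\<star> * (u - v) = 0"
    using assms(3)[OF in_module_diff[OF assms(1,2)]] by (simp add: adj_diff left_diff_distrib)
  then have "norm (u - v) = 0" by (metis cstar_identity norm_zero power_eq_0_iff)
  then show ?thesis by simp
qed

text \<open>Linearity is not demanded, as it follows from the existence of an adjoint. The value 0
  outside the modules makes equality of families plain equality of functions.\<close>

definition is_adjoint :: "('a::cstar_algebra set \<Rightarrow> 'a \<Rightarrow> 'a) \<Rightarrow> ('a set \<Rightarrow> 'a \<Rightarrow> 'a) \<Rightarrow> bool" where
  "is_adjoint f g \<longleftrightarrow>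
     (\<forall>E x. in_module E x \<longrightarrow> in_module E (f E x) \<and> in_module E (g E x)) \<and>
     (\<forall>E x. \<not> in_module E x \<longrightarrow> f E x = 0 \<and> g E x = 0) \<and>
     (\<forall>E x y. in_module E x \<longrightarrow> in_module E y \<longrightarrow> (f E x)\<^sup>\<star> * y = x\<^sup>\<star> * g E y)"

text \<open>One bound serves all \<open>E\<close>, as in an l-infinity product.\<close>

definition opbound :: "('a::real_normed_vector set \<Rightarrow> 'a \<Rightarrow> 'a) \<Rightarrow> real \<Rightarrow> bool" where
  "opbound f K \<longleftrightarrow> (\<forall>E x. norm (f E x) \<le> K * norm x)"

lemma is_adjointD:
  assumes "is_adjoint f g"
  shows "in_module E x \<Longrightarrow> in_module E (f E x)" "in_module E x \<Longrightarrow> in_module E (g E x)"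
    "\<not> in_module E x \<Longrightarrow> f E x = 0" "\<not> in_module E x \<Longrightarrow> g E x = 0"
    "in_module E x \<Longrightarrow> in_module E y \<Longrightarrow> (f E x)\<^sup>\<star> * y = x\<^sup>\<star> * g E y"
  using assms unfolding is_adjoint_def by blast+

lemma is_adjoint_sym: "is_adjoint f g \<Longrightarrow> is_adjoint g f"
  unfolding is_adjoint_def by (metis adj_adj adj_mult)

lemma is_adjoint_unique: assumes "is_adjoint f g" "is_adjoint f h" shows "g = h"
proof (intro ext)
  fix E x
  show "g E x = h E x"
  proof (cases "in_module E x")
    case True
    show ?thesis
      by (rule in_module_eqI[OF is_adjointD(2)[OF assms(1) True] is_adjointD(2)[OF assms(2) True]])
        (metis True assms is_adjointD(5) is_adjoint_sym)
  qed (metis assms is_adjointD(4))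
qed

lemma is_adjoint_add:
  assumes "is_adjoint f g" "in_module E x" "in_module E y"
  shows "f E (x + y) = f E x + f E y"
  by (rule in_module_eqI[where E = E])
    (simp_all add: assms is_adjointD[OF assms(1)] in_module_add adj_add distrib_right)

lemma is_adjoint_scaleC:
  assumes "is_adjoint f g" "in_module E x"
  shows "f E (c *\<^sub>C x) = c *\<^sub>C f E x"
  by (rule in_module_eqI[where E = E])
    (simp_all add: assms is_adjointD[OF assms(1)] in_module_scaleC adj_scaleC mult_scaleC_left)

lemma opbound_nonneg:
  assumes "opbound f K"
  obtains L where "opbound f L" "0 \<le> L"
proof (rule that)
  show "opbound f \<bar>K\<bar>"
    using assms unfolding opbound_def
    by (meson abs_ge_self mult_right_mono norm_ge_zero order_trans)
qed simp

lemma opbound_adjoint: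
  assumes "is_adjoint f g" "opbound f K" "0 \<le> K"
  shows "opbound g K"
  unfolding opbound_def
proof (intro allI)
  fix E x
  show "norm (g E x) \<le> K * norm x"
  proof (cases "in_module E x \<and> g E x \<noteq> 0")
    case True
    then have g: "in_module E (g E x)" by (simp add: is_adjointD[OF assms(1)])
    have "norm (g E x) * norm (g E x) = norm ((f E (g E x))\<^sup>\<star> * x)"
      using True g is_adjointD(5)[OF assms(1) g, of x] cstar_identity[of "g E x"]
      by (simp add: power2_eq_square)
    also have "\<dots> \<le> norm (f E (g E x)) * norm x"
      using norm_mult_ineq[of "(f E (g E x))\<^sup>\<star>" x] by simp
    also have "\<dots> \<le> K * norm (g E x) * norm x"
      using assms(2) by (intro mult_right_mono) (auto simp: opbound_def)
    finally have "norm (g E x) * norm (g E x) \<le> K * norm x * norm (g E x)" by (simp add: ac_simps)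
    then show ?thesis using True by simp
  qed (use assms(1,3) is_adjointD(4) in fastforce)
qed

typedef (overloaded) 'a::cstar_algebra opfam =
  "{f :: 'a set \<Rightarrow> 'a \<Rightarrow> 'a. \<exists>g. is_adjoint f g \<and> (\<exists>K. opbound f K)}"
proof -
  have "is_adjoint (\<lambda>E x :: 'a. 0) (\<lambda>E x. 0)" "opbound (\<lambda>E x :: 'a. 0) 0"
    by (auto simp: is_adjoint_def opbound_def intro: in_module_zero)
  then show ?thesis by blast
qed

setup_lifting type_definition_opfam

lift_definition opfam_adj :: "'a::cstar_algebra opfam \<Rightarrow> 'a opfam" is
  "\<lambda>f. THE g. is_adjoint f g"
proof -
  fix f :: "'a set \<Rightarrow> 'a \<Rightarrow> 'a"
  assume "\<exists>g. is_adjoint f g \<and> (\<exists>K. opbound f K)"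
  then obtain g K where g: "is_adjoint f g" and K: "opbound f K" by blast
  obtain L where L: "opbound f L" "0 \<le> L" using opbound_nonneg[OF K] .
  have "(THE g. is_adjoint f g) = g"
    by (rule the_equality[where P = "is_adjoint f", OF g]) (rule is_adjoint_unique[OF _ g])
  then show "\<exists>h. is_adjoint (THE g. is_adjoint f g) h \<and> (\<exists>K. opbound (THE g. is_adjoint f g) K)"
    using is_adjoint_sym[OF g] opbound_adjoint[OF g L] by metis
qed

lemma is_adjoint_opfam_adj: "is_adjoint (Rep_opfam f) (Rep_opfam (opfam_adj f))"
proof -
  obtain g where g: "is_adjoint (Rep_opfam f) g" using Rep_opfam[of f] by blast
  have "(THE g. is_adjoint (Rep_opfam f) g) = g"
    by (rule the_equality[where P = "is_adjoint (Rep_opfam f)", OF g])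
      (rule is_adjoint_unique[OF _ g])
  then show ?thesis using g by (simp add: opfam_adj.rep_eq)
qed

lemmas Rep_opfam_in_module = is_adjointD(1)[OF is_adjoint_opfam_adj]
lemmas Rep_opfam_outside = is_adjointD(3)[OF is_adjoint_opfam_adj]
lemmas Rep_opfam_adjoint = is_adjointD(5)[OF is_adjoint_opfam_adj]
lemmas Rep_opfam_add = is_adjoint_add[OF is_adjoint_opfam_adj]
lemmas Rep_opfam_scaleC = is_adjoint_scaleC[OF is_adjoint_opfam_adj]

lemma Rep_opfam_scaleR:
  "in_module E x \<Longrightarrow> Rep_opfam f E (r *\<^sub>R x) = r *\<^sub>R Rep_opfam f E x"
  by (metis Rep_opfam_scaleC scaleC_of_real)

lemma Rep_opfam_zero_arg: "Rep_opfam f E 0 = 0"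
proof (cases "in_module E 0")
  case True
  from Rep_opfam_scaleR[OF this, of f 0] show ?thesis by simp
qed (rule Rep_opfam_outside)

lemma opfam_eqI:
  assumes "\<And>E x. in_module E x \<Longrightarrow> Rep_opfam f E x = Rep_opfam g E x"
  shows "f = g"
proof -
  have "Rep_opfam f E x = Rep_opfam g E x" for E x
    using assms[of E x] Rep_opfam_outside[of E x] by metis
  then show ?thesis by (intro Rep_opfam_inject[THEN iffD1] ext)
qed

lemma is_adjoint_plus:
  "is_adjoint f f' \<Longrightarrow> is_adjoint g g' \<Longrightarrow>
    is_adjoint (\<lambda>E x. f E x + g E x) (\<lambda>E x. f' E x + g' E x)"
  unfolding is_adjoint_def by (simp add: in_module_add adj_add distrib_left distrib_right)

lemma is_adjoint_scale:
  "is_adjoint f f' \<Longrightarrow> is_adjoint (\<lambda>E x. c *\<^sub>C f E x) (\<lambda>E x. cnj c *\<^sub>C f' E x)"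
  unfolding is_adjoint_def
  by (simp add: in_module_scaleC adj_scaleC mult_scaleC_left mult_scaleC_right)

lemma is_adjoint_comp:
  "is_adjoint f f' \<Longrightarrow> is_adjoint g g' \<Longrightarrow>
    is_adjoint (\<lambda>E x. f E (g E x)) (\<lambda>E x. g' E (f' E x))"
proof -
  assume f: "is_adjoint f f'" and g: "is_adjoint g g'"
  \<comment> \<open>Outside the modules the inner operator returns 0, so the outer one has to fix 0:
    on a module by linearity, elsewhere by the default value.\<close>
  have z: "f E 0 = 0" "g' E 0 = 0" for E
    using is_adjoint_scaleC[OF f, of E 0 0] is_adjoint_scaleC[OF is_adjoint_sym[OF g], of E 0 0]
      is_adjointD(3)[OF f, of E 0] is_adjointD(4)[OF g, of E 0]
    by (metis cvec.scale_zero_left cvec.scale_zero_right)+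
  show ?thesis
    using f g unfolding is_adjoint_def by (auto simp: z[unfolded is_adjoint_def])
qed

lemma opbound_plus: "opbound f K \<Longrightarrow> opbound g L \<Longrightarrow> opbound (\<lambda>E x. f E x + g E x) (K + L)"
  unfolding opbound_def by (simp add: distrib_right norm_triangle_mono)

lemma opbound_scale: "opbound f K \<Longrightarrow> opbound (\<lambda>E x. c *\<^sub>C f E x) (cmod c * K)"
  unfolding opbound_def by (simp add: norm_scaleC mult.assoc mult_left_mono)

lemma opbound_comp:
  "opbound f K \<Longrightarrow> opbound g L \<Longrightarrow> 0 \<le> K \<Longrightarrow> opbound (\<lambda>E x. f E (g E x)) (K * L)"
  unfolding opbound_def by (metis mult.assoc mult_left_mono order_trans)

lemma opfam_obtain_bound:
  obtains K where "opbound (Rep_opfam f) K" "0 \<le> K"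
  using Rep_opfam[of f] opbound_nonneg by blast

section \<open>The Banach space of families\<close>

instantiation opfam :: (cstar_algebra) real_vector
begin

lift_definition zero_opfam :: "'a opfam" is "\<lambda>E x. 0"
proof -
  have "is_adjoint (\<lambda>E x :: 'a. 0) (\<lambda>E x. 0)" "opbound (\<lambda>E x :: 'a. 0) 0"
    by (auto simp: is_adjoint_def opbound_def intro: in_module_zero)
  then show "\<exists>g. is_adjoint (\<lambda>E x :: 'a. 0) g \<and> (\<exists>K. opbound (\<lambda>E x :: 'a. 0 :: 'a) K)" by blast
qed

lift_definition plus_opfam :: "'a opfam \<Rightarrow> 'a opfam \<Rightarrow> 'a opfam" is
  "\<lambda>f g E x. f E x + g E x"
  using is_adjoint_plus opbound_plus by blast

lift_definition scaleR_opfam :: "real \<Rightarrow> 'a opfam \<Rightarrow> 'a opfam" is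
  "\<lambda>r f E x. r *\<^sub>R f E x"
  unfolding scaleC_of_real[symmetric] using is_adjoint_scale opbound_scale by blast

definition "uminus_opfam (f :: 'a opfam) = (- 1) *\<^sub>R f"

definition "minus_opfam (f :: 'a opfam) g = f + (- g)"

instance
proof
  fix f g h :: "'a opfam" and r q :: real
  show "f + g + h = f + (g + h)" by transfer (simp add: add.assoc)
  show "f + g = g + f" by transfer (simp add: add.commute)
  show "0 + f = f" by transfer simp
  show "- f + f = 0" unfolding uminus_opfam_def by transfer simp
  show "f - g = f + - g" by (simp add: minus_opfam_def)
  show "r *\<^sub>R (f + g) = r *\<^sub>R f + r *\<^sub>R g" by transfer (simp add: scaleR_right_distrib)
  show "(r + q) *\<^sub>R f = r *\<^sub>R f + q *\<^sub>R f" by transfer (simp add: scaleR_left_distrib)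
  show "r *\<^sub>R q *\<^sub>R f = (r * q) *\<^sub>R f" by transfer simp
  show "1 *\<^sub>R f = f" by transfer simp
qed

end

lemma Rep_opfam_uminus: "Rep_opfam (- f) E x = - Rep_opfam f E x"
  unfolding uminus_opfam_def scaleR_opfam.rep_eq by simp

lemma Rep_opfam_minus: "Rep_opfam (f - g) E x = Rep_opfam f E x - Rep_opfam g E x"
  unfolding minus_opfam_def plus_opfam.rep_eq Rep_opfam_uminus by simp

instantiation opfam :: (cstar_algebra) real_normed_vector
begin

text \<open>The supremum runs over all pairs of a set and a vector. Vectors outside the modules
  contribute 0, and so does the vector 0, by the convention on division; hence the supremum is
  nonnegative.\<close>

definition norm_opfam :: "'a opfam \<Rightarrow> real" where
  "norm_opfam f = (SUP p. norm (Rep_opfam f (fst p) (snd p)) / norm (snd p))"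

definition dist_opfam :: "'a opfam \<Rightarrow> 'a opfam \<Rightarrow> real" where
  "dist_opfam f g = norm (f - g)"

definition sgn_opfam :: "'a opfam \<Rightarrow> 'a opfam" where
  "sgn_opfam f = f /\<^sub>R norm f"

definition uniformity_opfam :: "('a opfam \<times> 'a opfam) filter" where
  "uniformity_opfam = (INF e\<in>{0 <..}. principal {(x, y). dist x y < e})"

definition open_opfam :: "'a opfam set \<Rightarrow> bool" where
  "open_opfam S = (\<forall>x\<in>S. \<forall>\<^sub>F (x', y) in uniformity. x' = x \<longrightarrow> y \<in> S)"

lemma opbound_norm: "opbound (Rep_opfam f) (norm f)"
proof -
  obtain K where K: "opbound (Rep_opfam f) K" "0 \<le> K" by (rule opfam_obtain_bound)
  have bdd: "bdd_above (range (\<lambda>p. norm (Rep_opfam f (fst p) (snd p)) / norm (snd p)))"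
    using K by (intro bdd_aboveI[of _ K]) (auto simp: opbound_def divide_le_eq)
  have "norm (Rep_opfam f E x) \<le> norm f * norm x" for E x
  proof (cases "x = 0")
    case False
    have "norm (Rep_opfam f E x) / norm x \<le> norm f"
      unfolding norm_opfam_def using cSUP_upper[OF UNIV_I bdd, of "(E, x)"] by simp
    then show ?thesis using False by (simp add: divide_le_eq)
  qed (simp add: Rep_opfam_zero_arg)
  then show ?thesis by (simp add: opbound_def)
qed

lemma norm_opfam_le: "opbound (Rep_opfam f) K \<Longrightarrow> 0 \<le> K \<Longrightarrow> norm f \<le> K"
  unfolding norm_opfam_def by (rule cSUP_least) (auto simp: opbound_def divide_le_eq)

lemma norm_Rep_opfam: "norm (Rep_opfam f E x) \<le> norm f * norm x"
  using opbound_norm unfolding opbound_def by blast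

lemma norm_opfam_nonneg: "0 \<le> norm (f :: 'a opfam)"
proof -
  obtain K where K: "opbound (Rep_opfam f) K" "0 \<le> K" by (rule opfam_obtain_bound)
  have "bdd_above (range (\<lambda>p. norm (Rep_opfam f (fst p) (snd p)) / norm (snd p)))"
    using K by (intro bdd_aboveI[of _ K]) (auto simp: opbound_def divide_le_eq)
  from cSUP_upper[OF UNIV_I this, of "({}, 0)"] show ?thesis by (simp add: norm_opfam_def)
qed

instance
proof
  fix f g :: "'a opfam" and r :: real and S :: "'a opfam set"
  show "dist f g = norm (f - g)" by (simp add: dist_opfam_def)
  show "sgn f = f /\<^sub>R norm f" by (simp add: sgn_opfam_def)
  show "uniformity = (INF e\<in>{0 <..}. principal {(x, y :: 'a opfam). dist x y < e})"
    by (simp add: uniformity_opfam_def)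
  show "open S = (\<forall>x\<in>S. \<forall>\<^sub>F (x', y) in uniformity. x' = x \<longrightarrow> y \<in> S)"
    by (simp add: open_opfam_def)
  show "norm f = 0 \<longleftrightarrow> f = 0"
  proof
    assume "norm f = 0"
    then have "Rep_opfam f E x = Rep_opfam 0 E x" for E x
      using norm_Rep_opfam[of f E x] by (simp add: zero_opfam.rep_eq)
    then show "f = 0" by (intro opfam_eqI)
  next
    assume "f = 0"
    then show "norm f = 0" by (simp add: norm_opfam_def zero_opfam.rep_eq)
  qed
  show "norm (f + g) \<le> norm f + norm g"
    by (intro norm_opfam_le add_nonneg_nonneg norm_opfam_nonneg)
      (simp add: plus_opfam.rep_eq opbound_plus opbound_norm)
  have le: "norm (r *\<^sub>R f) \<le> \<bar>r\<bar> * norm f" for r and f :: "'a opfam"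
    using opbound_norm[of f]
    by (intro norm_opfam_le mult_nonneg_nonneg norm_opfam_nonneg)
      (auto simp: scaleR_opfam.rep_eq opbound_def mult.assoc intro: mult_left_mono)
  show "norm (r *\<^sub>R f) = \<bar>r\<bar> * norm f"
  proof (cases "r = 0")
    case True
    then show ?thesis
      using le[of r f] norm_opfam_nonneg[of "r *\<^sub>R f"] by simp
  next
    case False
    have "\<bar>r\<bar> * norm f = \<bar>r\<bar> * norm ((1 / r) *\<^sub>R r *\<^sub>R f)" using False by simp
    also have "\<dots> \<le> \<bar>r\<bar> * (\<bar>1 / r\<bar> * norm (r *\<^sub>R f))" by (intro mult_left_mono le) simp
    also have "\<dots> = norm (r *\<^sub>R f)" using False by simp
    finally show ?thesis using le[of r f] by simp
  qed
qed

end

lemma opfam_adj_eqI: "is_adjoint (Rep_opfam f) (Rep_opfam g) \<Longrightarrow> opfam_adj f = g"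
  using is_adjoint_unique[OF is_adjoint_opfam_adj] Rep_opfam_inject by blast

lemma opfam_adj_add: "opfam_adj (f + g) = opfam_adj f + opfam_adj g"
  by (rule opfam_adj_eqI) (simp add: plus_opfam.rep_eq is_adjoint_plus is_adjoint_opfam_adj)

lemma opfam_adj_scaleR: "opfam_adj (r *\<^sub>R f) = r *\<^sub>R opfam_adj f"
  using is_adjoint_scale[OF is_adjoint_opfam_adj, of "complex_of_real r" f]
  by (intro opfam_adj_eqI) (simp add: scaleR_opfam.rep_eq scaleC_of_real)

lemma opfam_adj_adj: "opfam_adj (opfam_adj f) = f"
  by (rule opfam_adj_eqI) (rule is_adjoint_sym[OF is_adjoint_opfam_adj])

lemma norm_opfam_adj_le: "norm (opfam_adj f) \<le> norm f"
  by (rule norm_opfam_le[OF opbound_adjoint[OF is_adjoint_opfam_adj opbound_norm]]) simp_all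

lemma bounded_linear_opfam_adj: "bounded_linear opfam_adj"
  by (rule bounded_linear_intro[where K = 1])
    (simp_all add: opfam_adj_add opfam_adj_scaleR norm_opfam_adj_le)

lemma bounded_linear_Rep_opfam: "bounded_linear (\<lambda>f. Rep_opfam f E x)"
  by (rule bounded_linear_intro[where K = "norm x"])
    (simp_all add: plus_opfam.rep_eq scaleR_opfam.rep_eq norm_Rep_opfam)

instance opfam :: (cstar_algebra) banach
proof
  fix X :: "nat \<Rightarrow> 'a opfam"
  assume X: "Cauchy X"
  obtain C where C: "\<And>n. norm (X n) \<le> C"
    using cauchy_imp_bounded[OF X] unfolding bounded_iff by blast
  have lims: "\<exists>F. \<forall>E x. (\<lambda>n. Rep_opfam (Z n) E x) \<longlonglongrightarrow> F E x"
    if "Cauchy Z" for Z :: "nat \<Rightarrow> 'a opfam"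
  proof -
    have "(\<lambda>n. Rep_opfam (Z n) E x) \<longlonglongrightarrow> lim (\<lambda>n. Rep_opfam (Z n) E x)" for E x
      using bounded_linear.Cauchy[OF bounded_linear_Rep_opfam that]
      by (simp add: Cauchy_convergent_iff convergent_LIMSEQ_iff)
    then show ?thesis by (intro exI allI)
  qed
  from lims[OF X] obtain F where F: "\<And>E x. (\<lambda>n. Rep_opfam (X n) E x) \<longlonglongrightarrow> F E x" by blast
  \<comment> \<open>The adjoints form a Cauchy sequence too, and their limit is the adjoint of the
    limit.\<close>
  from lims[OF bounded_linear.Cauchy[OF bounded_linear_opfam_adj X]]
  obtain G where G: "\<And>E x. (\<lambda>n. Rep_opfam (opfam_adj (X n)) E x) \<longlonglongrightarrow> G E x" by blast
  have "is_adjoint F G"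
    unfolding is_adjoint_def
  proof (intro conjI allI impI)
    fix E and x y :: 'a
    show "in_module E (F E x)" "in_module E (G E x)" if "in_module E x"
      using that in_module_LIMSEQ[OF _ F] in_module_LIMSEQ[OF _ G] Rep_opfam_in_module by blast+
    show "F E x = 0" "G E x = 0" if "\<not> in_module E x"
      using F[of E x] G[of E x] that by (simp_all add: Rep_opfam_outside LIMSEQ_const_iff)
    show "(F E x)\<^sup>\<star> * y = x\<^sup>\<star> * G E y" if "in_module E x" "in_module E y"
    proof (rule LIMSEQ_unique)
      show "(\<lambda>n. (Rep_opfam (X n) E x)\<^sup>\<star> * y) \<longlonglongrightarrow> (F E x)\<^sup>\<star> * y"
        by (intro tendsto_intros tendsto_adj F)
      show "(\<lambda>n. (Rep_opfam (X n) E x)\<^sup>\<star> * y) \<longlonglongrightarrow> x\<^sup>\<star> * G E y"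
        unfolding Rep_opfam_adjoint[OF that] by (intro tendsto_intros G)
    qed
  qed
  moreover have "opbound F C"
    unfolding opbound_def
  proof (intro allI)
    fix E x
    show "norm (F E x) \<le> C * norm x"
    proof (rule Lim_norm_ubound[OF _ F])
      show "\<forall>\<^sub>F n in sequentially. norm (Rep_opfam (X n) E x) \<le> C * norm x"
        by (intro always_eventually allI order_trans[OF norm_Rep_opfam] mult_right_mono C) simp
    qed simp
  qed
  ultimately have Rep: "Rep_opfam (Abs_opfam F) = F"
    by (intro Abs_opfam_inverse) blast
  have "X \<longlonglongrightarrow> Abs_opfam F"
  proof (rule LIMSEQ_I)
    fix e :: real assume "0 < e"
    then obtain N where N: "\<And>m n. m \<ge> N \<Longrightarrow> n \<ge> N \<Longrightarrow> norm (X m - X n) < e / 2"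
      using CauchyD[OF X, of "e / 2"] by auto
    have "norm (X n - Abs_opfam F) \<le> e / 2" if "n \<ge> N" for n
    proof (rule norm_opfam_le)
      show "opbound (Rep_opfam (X n - Abs_opfam F)) (e / 2)"
        unfolding opbound_def Rep_opfam_minus Rep
      proof (intro allI)
        fix E x
        show "norm (Rep_opfam (X n) E x - F E x) \<le> e / 2 * norm x"
        proof (rule Lim_norm_ubound)
          show "(\<lambda>m. Rep_opfam (X n) E x - Rep_opfam (X m) E x)
            \<longlonglongrightarrow> Rep_opfam (X n) E x - F E x"
            by (intro tendsto_intros F)
          have "norm (Rep_opfam (X n - X m) E x) \<le> e / 2 * norm x" if "m \<ge> N" for m
            using N[OF \<open>n \<ge> N\<close> that]
            by (intro order_trans[OF norm_Rep_opfam] mult_right_mono) auto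
          then show "\<forall>\<^sub>F m in sequentially.
              norm (Rep_opfam (X n) E x - Rep_opfam (X m) E x) \<le> e / 2 * norm x"
            unfolding eventually_sequentially Rep_opfam_minus by blast
        qed simp
      qed
    qed (use \<open>0 < e\<close> in simp)
    then show "\<exists>N. \<forall>n\<ge>N. norm (X n - Abs_opfam F) < e"
      using \<open>0 < e\<close> by (intro exI[of _ N]) force
  qed
  then show "convergent X" by (auto simp: convergent_def)
qed

section \<open>The C*-algebra of families\<close>

instantiation opfam :: (cstar_algebra) "{cstar_algebra, monoid_mult}"
begin

lift_definition one_opfam :: "'a opfam" is "\<lambda>E x. if in_module E x then x else 0"
proof -
  have "is_adjoint (\<lambda>E x :: 'a. if in_module E x then x else 0) (\<lambda>E x. if in_module E x then x else 0)"
    "opbound (\<lambda>E x :: 'a. if in_module E x then x else 0) 1"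
    by (auto simp: is_adjoint_def opbound_def)
  then show "\<exists>g. is_adjoint (\<lambda>E x :: 'a. if in_module E x then x else 0) g \<and>
    (\<exists>K. opbound (\<lambda>E x :: 'a. if in_module E x then x else 0) K)" by blast
qed

lift_definition times_opfam :: "'a opfam \<Rightarrow> 'a opfam \<Rightarrow> 'a opfam" is
  "\<lambda>f g E x. f E (g E x)"
proof -
  fix f g :: "'a set \<Rightarrow> 'a \<Rightarrow> 'a"
  assume "\<exists>f'. is_adjoint f f' \<and> (\<exists>K. opbound f K)" "\<exists>g'. is_adjoint g g' \<and> (\<exists>K. opbound g K)"
  then obtain f' g' K L where f: "is_adjoint f f'" "opbound f K" and g: "is_adjoint g g'" "opbound g L"
    by blast
  obtain K' where K': "opbound f K'" "0 \<le> K'" using opbound_nonneg[OF f(2)] .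
  show "\<exists>h. is_adjoint (\<lambda>E x. f E (g E x)) h \<and> (\<exists>K. opbound (\<lambda>E x. f E (g E x)) K)"
    using is_adjoint_comp[OF f(1) g(1)] opbound_comp[OF K'(1) g(2) K'(2)] by blast
qed

lift_definition scaleC_opfam :: "complex \<Rightarrow> 'a opfam \<Rightarrow> 'a opfam" is
  "\<lambda>c f E x. c *\<^sub>C f E x"
  using is_adjoint_scale opbound_scale by blast

definition adj_opfam :: "'a opfam \<Rightarrow> 'a opfam" where "adj_opfam = opfam_adj"

instance
proof
  fix f g h :: "'a opfam" and r :: real and c d :: complex
  note rep = times_opfam.rep_eq plus_opfam.rep_eq scaleR_opfam.rep_eq scaleC_opfam.rep_eq
    one_opfam.rep_eq Rep_opfam_in_module
  show "f * g * h = f * (g * h)" "1 * f = f" "f * 1 = f" "(f + g) * h = f * h + g * h"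
    "f * (g + h) = f * g + f * h" "r *\<^sub>R f * g = r *\<^sub>R (f * g)" "f * r *\<^sub>R g = r *\<^sub>R (f * g)"
    "c *\<^sub>C (f + g) = c *\<^sub>C f + c *\<^sub>C g" "(c + d) *\<^sub>C f = c *\<^sub>C f + d *\<^sub>C f"
    "c *\<^sub>C d *\<^sub>C f = (c * d) *\<^sub>C f" "complex_of_real r *\<^sub>C f = r *\<^sub>R f"
    "c *\<^sub>C f * g = c *\<^sub>C (f * g)" "f * c *\<^sub>C g = c *\<^sub>C (f * g)"
    by (intro opfam_eqI, simp add: rep Rep_opfam_add Rep_opfam_scaleR Rep_opfam_scaleC
        scaleC_add_right scaleC_add_left scaleC_scaleC scaleC_of_real)+
  show "norm (f * g) \<le> norm f * norm g"
    by (intro norm_opfam_le mult_nonneg_nonneg norm_ge_zero)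
      (simp add: times_opfam.rep_eq opbound_comp opbound_norm)
  have le: "norm (c *\<^sub>C f) \<le> cmod c * norm f" for c and f :: "'a opfam"
    by (intro norm_opfam_le mult_nonneg_nonneg norm_ge_zero)
      (simp add: scaleC_opfam.rep_eq opbound_scale opbound_norm)
  show "norm (c *\<^sub>C f) = cmod c * norm f"
  proof (cases "c = 0")
    case True
    then show ?thesis using le[of c f] by simp
  next
    case False
    have "f = (1 / c) *\<^sub>C c *\<^sub>C f"
      using False by (intro opfam_eqI) (simp add: scaleC_opfam.rep_eq scaleC_scaleC)
    then have "cmod c * norm f \<le> cmod c * (cmod (1 / c) * norm (c *\<^sub>C f))"
      by (metis le mult_left_mono norm_ge_zero)
    also have "\<dots> = norm (c *\<^sub>C f)" using False by (simp add: norm_divide)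
    finally show ?thesis using le[of c f] by simp
  qed
  show "(f + g)\<^sup>\<star> = f\<^sup>\<star> + g\<^sup>\<star>" "(f\<^sup>\<star>)\<^sup>\<star> = f"
    by (simp_all add: adj_opfam_def opfam_adj_add opfam_adj_adj)
  show "(c *\<^sub>C f)\<^sup>\<star> = cnj c *\<^sub>C f\<^sup>\<star>"
    unfolding adj_opfam_def
    by (rule opfam_adj_eqI) (simp add: scaleC_opfam.rep_eq is_adjoint_scale is_adjoint_opfam_adj)
  show "(f * g)\<^sup>\<star> = g\<^sup>\<star> * f\<^sup>\<star>"
    unfolding adj_opfam_def
    by (rule opfam_adj_eqI) (simp add: times_opfam.rep_eq is_adjoint_comp is_adjoint_opfam_adj)
  have mult: "norm (f * g) \<le> norm f * norm g" for f g :: "'a opfam"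
    by (intro norm_opfam_le mult_nonneg_nonneg norm_ge_zero)
      (simp add: times_opfam.rep_eq opbound_comp opbound_norm)
  show "norm (f\<^sup>\<star> * f) = (norm f)\<^sup>2"
  proof (rule antisym)
    show "norm (f\<^sup>\<star> * f) \<le> (norm f)\<^sup>2"
      using mult[of "f\<^sup>\<star>" f] mult_right_mono[OF norm_opfam_adj_le[of f] norm_ge_zero[of f]]
      unfolding adj_opfam_def power2_eq_square by linarith
    let ?K = "norm (f\<^sup>\<star> * f)"
    have "norm f \<le> sqrt ?K"
    proof (rule norm_opfam_le)
      show "opbound (Rep_opfam f) (sqrt ?K)"
        unfolding opbound_def
      proof (intro allI)
        fix E x
        show "norm (Rep_opfam f E x) \<le> sqrt ?K * norm x"
        proof (cases "in_module E x")
          case True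
          have "(norm (Rep_opfam f E x))\<^sup>2 = norm (x\<^sup>\<star> * Rep_opfam (f\<^sup>\<star> * f) E x)"
            unfolding cstar_identity[symmetric] times_opfam.rep_eq adj_opfam_def
            using Rep_opfam_adjoint[OF True Rep_opfam_in_module[OF True], of f f] by simp
          also have "\<dots> \<le> norm x * (?K * norm x)"
            using norm_mult_ineq[of "x\<^sup>\<star>" "Rep_opfam (f\<^sup>\<star> * f) E x"]
              mult_left_mono[OF norm_Rep_opfam[of "f\<^sup>\<star> * f" E x] norm_ge_zero[of x]] by simp
          also have "\<dots> = (sqrt ?K * norm x)\<^sup>2" by (simp add: power_mult_distrib power2_eq_square)
          finally show ?thesis by (rule power2_le_imp_le) simp
        qed (simp add: Rep_opfam_outside)
      qed
    qed simp
    then show "(norm f)\<^sup>2 \<le> ?K"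
      using power_mono[of "norm f" "sqrt ?K" 2] by simp
  qed
qed

end

section \<open>Single operators as families\<close>

text \<open>A bound is asked of \<open>f\<close> only; \<open>adjointable_on_sym\<close> derives one
  for \<open>g\<close>.\<close>

definition adjointable_on :: "'a::cstar_algebra set \<Rightarrow> ('a \<Rightarrow> 'a) \<Rightarrow> ('a \<Rightarrow> 'a) \<Rightarrow> bool" where
  "adjointable_on I f g \<longleftrightarrow> closed I \<and> csubspace I \<and> (\<forall>x\<in>I. f x \<in> I \<and> g x \<in> I) \<and>
     (\<exists>K. \<forall>x\<in>I. norm (f x) \<le> K * norm x) \<and> (\<forall>x\<in>I. \<forall>y\<in>I. (f x)\<^sup>\<star> * y = x\<^sup>\<star> * g y)"

text \<open>The embedding of one factor into the product. The identity on \<open>I\<close> does not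
  in general become the unit of the product.\<close>

definition opfam_at :: "'a::cstar_algebra set \<Rightarrow> ('a \<Rightarrow> 'a) \<Rightarrow> 'a opfam" where
  "opfam_at I f = Abs_opfam (\<lambda>E x. if E = I \<and> in_module E x then f x else 0)"

lemma adjointable_on_is_adjoint:
  assumes "adjointable_on I f g"
  shows "is_adjoint (\<lambda>E x. if E = I \<and> in_module E x then f x else 0)
    (\<lambda>E x. if E = I \<and> in_module E x then g x else 0)"
  using assms unfolding is_adjoint_def adjointable_on_def
  by (auto simp: in_module_def cvec.subspace_0)

lemma Rep_opfam_at:
  assumes "adjointable_on I f g"
  shows "Rep_opfam (opfam_at I f) = (\<lambda>E x. if E = I \<and> in_module E x then f x else 0)"
proof -
  obtain K where K: "\<And>x. x \<in> I \<Longrightarrow> norm (f x) \<le> K * norm x"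
    using assms unfolding adjointable_on_def by blast
  have "norm (f x) \<le> \<bar>K\<bar> * norm x" if "x \<in> I" for x
    using K[OF that] by (meson abs_ge_self mult_right_mono norm_ge_zero order_trans)
  then have "opbound (\<lambda>E x. if E = I \<and> in_module E x then f x else 0) \<bar>K\<bar>"
    by (auto simp: opbound_def in_module_def)
  with adjointable_on_is_adjoint[OF assms] show ?thesis
    unfolding opfam_at_def by (subst Abs_opfam_inverse) auto
qed

lemma adjointable_on_sym: assumes "adjointable_on I f g" shows "adjointable_on I g f"
proof -
  have r: "Rep_opfam ((opfam_at I f)\<^sup>\<star>) = (\<lambda>E x. if E = I \<and> in_module E x then g x else 0)"
    unfolding adj_opfam_def
    using is_adjoint_unique[OF is_adjoint_opfam_adj, of "opfam_at I f"]
      adjointable_on_is_adjoint[OF assms] Rep_opfam_at[OF assms] by presburger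
  have "norm (g x) \<le> norm ((opfam_at I f)\<^sup>\<star>) * norm x" if "x \<in> I" for x
    using norm_Rep_opfam[of "(opfam_at I f)\<^sup>\<star>" I x] that assms
    unfolding r by (simp add: in_module_def adjointable_on_def)
  moreover have "(g x)\<^sup>\<star> * y = x\<^sup>\<star> * f y" if "x \<in> I" "y \<in> I" for x y
    using assms that unfolding adjointable_on_def by (metis adj_adj adj_mult)
  ultimately show ?thesis using assms unfolding adjointable_on_def by blast
qed

lemma adj_opfam_at: assumes "adjointable_on I f g" shows "(opfam_at I f)\<^sup>\<star> = opfam_at I g"
  unfolding adj_opfam_def
  by (rule opfam_adj_eqI)
    (simp add: Rep_opfam_at[OF assms] Rep_opfam_at[OF adjointable_on_sym[OF assms]]
      adjointable_on_is_adjoint[OF assms])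

section \<open>Factorization\<close>

text \<open>Plays the role of a unitization, in which \<open>pos\<close> and square roots make
  sense.\<close>

definition left_mult :: "'a::cstar_algebra \<Rightarrow> 'a opfam" where
  "left_mult a = opfam_at UNIV ((*) a)"

lemma in_module_UNIV [simp]: "in_module UNIV x"
  by (simp add: in_module_def)

lemma adjointable_on_left_mult: "adjointable_on UNIV ((*) a) ((*) (a\<^sup>\<star>))"
  unfolding adjointable_on_def
  by (auto simp: adj_mult mult.assoc intro: norm_mult_ineq)

lemma Rep_left_mult: "Rep_opfam (left_mult a) E x = (if E = UNIV then a * x else 0)"
  unfolding left_mult_def by (simp add: Rep_opfam_at[OF adjointable_on_left_mult])

lemma left_mult_mult: "left_mult (a * b) = left_mult a * left_mult b"
  by (rule opfam_eqI) (simp add: Rep_left_mult times_opfam.rep_eq mult.assoc)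

lemma left_mult_adj: "left_mult (a\<^sup>\<star>) = (left_mult a)\<^sup>\<star>"
  unfolding left_mult_def by (rule adj_opfam_at[OF adjointable_on_left_mult, symmetric])

lemma norm_left_mult [simp]: "norm (left_mult a) = norm a"
proof (rule antisym)
  show "norm (left_mult a) \<le> norm a"
    by (rule norm_opfam_le) (auto simp: opbound_def Rep_left_mult norm_mult_ineq)
  \<comment> \<open>The norm is attained at the vector \<open>a\<^sup>\<star>\<close>.\<close>
  have "norm a * norm a \<le> norm (left_mult a) * norm a"
    using norm_Rep_opfam[of "left_mult a" UNIV "a\<^sup>\<star>"]
    by (simp add: Rep_left_mult norm_mult_adj power2_eq_square)
  then show "norm a \<le> norm (left_mult a)" by (cases "a = 0") auto
qed

lemma bounded_linear_left_mult: "bounded_linear left_mult"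
  by (rule bounded_linear_intro[where K = 1])
    (auto intro!: opfam_eqI simp: Rep_left_mult plus_opfam.rep_eq scaleR_opfam.rep_eq distrib_right)

lemmas linear_left_mult = bounded_linear.linear[OF bounded_linear_left_mult]

text \<open>\<open>left_mult\<close> is isometric, so the image is closed. Roots of left
  multiplications by elements of \<open>C\<close> are therefore again left multiplications by
  elements of \<open>C\<close>.\<close>

lemma closed_subalgebra_left_mult:
  assumes "closed_subalgebra C" shows "closed_subalgebra (left_mult ` C)"
proof -
  have C: "closed C" "subspace C" "\<And>x y. x \<in> C \<Longrightarrow> y \<in> C \<Longrightarrow> x * y \<in> C"
    using assms by (auto simp: closed_subalgebra_def)
  have "closed (left_mult ` C)"
    unfolding closed_sequential_limits
  proof (intro allI impI, elim conjE)
    fix X l assume X: "\<forall>n. X n \<in> left_mult ` C" and l: "X \<longlonglongrightarrow> l"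
    then have "\<forall>n. \<exists>c. c \<in> C \<and> X n = left_mult c" by blast
    then obtain c where c: "\<And>n. c n \<in> C" "\<And>n. X n = left_mult (c n)" by metis
    have "norm (c m - c n) = norm (X m - X n)" for m n
      unfolding c(2) linear_diff[OF linear_left_mult, symmetric] by simp
    then have "Cauchy c"
      using LIMSEQ_imp_Cauchy[OF l] unfolding Cauchy_def dist_norm by simp
    then obtain d where d: "c \<longlonglongrightarrow> d" using Cauchy_convergent_iff convergent_def by blast
    then have "X \<longlonglongrightarrow> left_mult d"
      unfolding c(2)[THEN ext[of X]] by (rule bounded_linear.tendsto[OF bounded_linear_left_mult])
    then show "l \<in> left_mult ` C"
      using LIMSEQ_unique[OF l] closed_sequentially[OF C(1) c(1) d] by blast
  qed
  moreover have "subspace (left_mult ` C)"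
    by (rule linear_subspace_image[OF linear_left_mult C(2)])
  ultimately show ?thesis
    using C(3) by (auto simp: closed_subalgebra_def simp flip: left_mult_mult)
qed

lemma pos_one_minus: assumes "pos x" "norm x \<le> 1" shows "pos (1 - x)"
proof -
  obtain s where "s * s = 1 - x" "s\<^sup>\<star> = s"
    using ex_sqrt[of "1 - x"] assms pos_sa[of x] by (auto simp: adj_diff)
  then show ?thesis using pos_square by metis
qed

lemma norm_sqrt_le: "pos s \<Longrightarrow> norm (s * s) \<le> 1 \<Longrightarrow> norm s \<le> 1"
  using power_le_imp_le_base[of "norm s" 1 1] by (simp add: norm_square_sa pos_sa abs_square_le_1)

text \<open>With \<open>s\<^sup>8 = (xx\<^sup>\<star>)\<^sup>2\<close> and \<open>p = 1 - s\<close>, the C*-identity gives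
  \<open>norm (p\<^sup>2\<^sup>jx) ^ 4 = norm ((sp\<^sup>j)\<^sup>8) \<le> (j + 1) powr -8\<close>. So \<open>n = \<Sum>j. p\<^sup>2\<^sup>jx\<close>
  converges, and \<open>(1 - p\<^sup>2)n = x\<close>.\<close>

lemma factorization_contraction:
  fixes x :: "'a::cstar_algebra"
  assumes C: "closed_subalgebra C" "x * x\<^sup>\<star> \<in> C"
    and N: "closed N" "subspace N" "x \<in> N" "\<And>c n. c \<in> C \<Longrightarrow> n \<in> N \<Longrightarrow> c * n \<in> N"
    and x: "norm x \<le> 1"
  shows "\<exists>c\<in>C. \<exists>n\<in>N. x = c * n"
proof -
  define H where "H = left_mult (x * x\<^sup>\<star>)"
  have LC: "closed_subalgebra (left_mult ` C)" by (rule closed_subalgebra_left_mult[OF C(1)])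
  then have mult: "a * b \<in> left_mult ` C" if "a \<in> left_mult ` C" "b \<in> left_mult ` C" for a b
    using that unfolding closed_subalgebra_def by blast
  have Hsa: "H\<^sup>\<star> = H" by (simp add: H_def adj_mult adj_adj flip: left_mult_adj)
  have "norm H \<le> 1" using x by (simp add: H_def norm_mult_adj power_le_one)
  \<comment> \<open>\<open>pos_square\<close> applies to the square of \<open>H\<close>, whereas
    positivity of \<open>H\<close> itself is not at hand; so the roots start from
    \<open>H * H\<close>.\<close>
  then have T: "norm (H * H) \<le> 1" "pos (H * H)" "H * H \<in> left_mult ` C"
    using Hsa C(2) mult by (auto simp: norm_square_sa power_le_one pos_square H_def)
  have root: "\<exists>s. pos s \<and> norm s \<le> 1 \<and> s \<in> left_mult ` C \<and> s * s = t \<and> H * s = s * H"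
    if t: "pos t" "norm t \<le> 1" "t \<in> left_mult ` C" "H * t = t * H" for t
  proof -
    obtain s where s: "pos s" "s * s = t" "\<And>C. closed_subalgebra C \<Longrightarrow> t \<in> C \<Longrightarrow> s \<in> C"
      using pos_obtain_sqrt[OF t(1)] by blast
    have "s \<in> {y. H * y = y * H}"
      using s(3)[OF closed_subalgebra_commutant] t(4) by simp
    then show ?thesis using s t LC norm_sqrt_le[OF s(1)] by auto
  qed
  obtain s1 where s1: "pos s1" "norm s1 \<le> 1" "s1 \<in> left_mult ` C" "s1 * s1 = H * H" "H * s1 = s1 * H"
    using root[of "H * H"] T by (auto simp: mult.assoc)
  obtain s2 where s2: "pos s2" "norm s2 \<le> 1" "s2 \<in> left_mult ` C" "s2 * s2 = s1" "H * s2 = s2 * H"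
    using root[OF s1(1,2,3,5)] by blast
  \<comment> \<open>A third root is taken because the same estimate with
    \<open>s ^ 4 = H * H\<close> would bound \<open>norm (z j)\<close> only by 1 / (j + 1), which is
    not summable.\<close>
  obtain s where s: "pos s" "norm s \<le> 1" "s \<in> left_mult ` C" "s * s = s2" "H * s = s * H"
    using root[OF s2(1,2,3,5)] by blast
  define p where "p = 1 - s"
  have s8: "s ^ 8 = H * H"
  proof -
    have "s ^ 8 = ((s * s) * (s * s)) * ((s * s) * (s * s))"
      by (simp add: eval_nat_numeral mult.assoc)
    then show ?thesis by (simp add: s s2 s1)
  qed
  \<comment> \<open>A polynomial in \<open>s\<close> without constant term, hence left
    multiplication by an element \<open>c\<close> of \<open>C\<close>.\<close>
  have "1 - p * p = s + s - s * s" by (simp add: p_def algebra_simps)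
  also have "\<dots> \<in> left_mult ` C"
    using LC s(3) mult by (simp add: closed_subalgebra_def subspace_add subspace_diff)
  finally obtain c where c: "c \<in> C" "left_mult c = 1 - p * p" by auto
  \<comment> \<open>This is \<open>p * p\<close> applied \<open>j\<close> times to \<open>x\<close>,
    written without a unit.\<close>
  define z where "z j = ((\<lambda>y. y - c * y) ^^ j) x" for j
  have z_Suc: "z (Suc j) = z j - c * z j" for j by (simp add: z_def)
  have zN: "z j \<in> N" for j
    by (induction j) (use N c in \<open>simp_all add: z_Suc subspace_diff, simp add: z_def\<close>)
  have Lz: "left_mult (z j) = (p * p) ^ j * left_mult x" for j
  proof (induction j)
    case (Suc j)
    have "left_mult (z (Suc j)) = left_mult (z j) - (1 - p * p) * left_mult (z j)"
      by (simp add: z_Suc linear_diff[OF linear_left_mult] left_mult_mult c)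
    also have "\<dots> = (p * p) * left_mult (z j)" by (simp add: left_diff_distrib)
    finally show ?case by (simp add: Suc mult.assoc)
  qed (simp add: z_def)
  have Hp: "p ^ j * H = H * p ^ j" for j
    using s(5) by (intro commute_power[symmetric]) (simp add: p_def algebra_simps)
  have psa: "p\<^sup>\<star> = p" using pos_sa[OF s(1)] by (simp add: p_def adj_diff)
  have bound: "norm (z j) \<le> inverse (real (Suc j) ^ 2)" for j
  proof -
    define P where "P = p ^ j"
    have HP: "P * (H * y) = H * (P * y)" for y
      using Hp[of j] unfolding P_def by (metis mult.assoc)
    have "P * s = s * P"
      unfolding P_def by (intro commute_power[symmetric]) (simp add: p_def algebra_simps)
    then have sP: "P * s ^ k = s ^ k * P" for k by (rule commute_power)
    have sP': "P * (s ^ k * y) = s ^ k * (P * y)" for k y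
      using sP[of k] by (metis mult.assoc)
    have sPk: "(s * P) ^ k = s ^ k * P ^ k" for k
      by (induction k) (simp_all add: mult.assoc sP')
    define W where "W = left_mult (z j * (z j)\<^sup>\<star>)"
    have "(p * p) ^ j = P * P"
      unfolding P_def by (metis power2_eq_square power_mult power_add mult_2 mult.commute)
    moreover have "P\<^sup>\<star> = P" by (simp add: P_def adj_power psa)
    \<comment> \<open>Squaring turns the four factors \<open>P\<close> into \<open>P ^ 8\<close>,
      which matches \<open>s ^ 8 = H * H\<close>; this is why each step of \<open>z\<close> uses
      \<open>p * p\<close>.\<close>
    ultimately have "W = H * (P * (P * (P * P)))"
      by (simp add: W_def H_def[symmetric] left_mult_mult left_mult_adj Lz adj_mult)
        (simp add: H_def left_mult_mult left_mult_adj mult.assoc HP[unfolded H_def left_mult_mult left_mult_adj mult.assoc])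
    then have "W * W = H * H * P ^ 8"
      by (simp add: eval_nat_numeral mult.assoc HP)
    also have "\<dots> = (s * P) ^ 8" by (simp add: sPk s8)
    finally have "(norm W)\<^sup>2 = norm ((s * P) ^ 8)"
      by (metis W_def adj_adj adj_mult left_mult_adj norm_square_sa)
    also have "\<dots> \<le> norm (s * P) ^ 8"
    proof -
      have "norm (y ^ Suc k) \<le> norm y ^ Suc k" for y :: "'a opfam" and k
      proof (induction k)
        case (Suc k)
        then show ?case
          using norm_mult_ineq[of y "y ^ Suc k"] mult_left_mono[OF Suc norm_ge_zero[of y]] by simp
      qed simp
      from this[of _ 7] show ?thesis by simp
    qed
    also have "\<dots> \<le> inverse (real (Suc j)) ^ 8"
      using norm_mult_power_le[OF s(1) pos_one_minus[OF s(1,2)], of j]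
      by (intro power_mono) (auto simp: P_def p_def divide_inverse add.commute)
    finally have "(norm (z j)) ^ 4 \<le> (inverse (real (Suc j) ^ 2)) ^ 4"
      by (simp add: W_def norm_mult_adj power_inverse flip: power_mult)
    then show ?thesis by (rule power_le_imp_le_base[of _ 3, simplified]) simp
  qed
  have "summable (\<lambda>j. inverse (real (Suc j) ^ 2))"
    using inverse_power_summable[of 2, where 'a = real] by (subst summable_Suc_iff) simp
  then have sz: "summable z" by (rule summable_comparison_test'[of _ 0]) (rule bound)
  have "z \<longlonglongrightarrow> 0" by (rule summable_LIMSEQ_zero[OF sz])
  \<comment> \<open>\<open>c * z j\<close> is the difference of \<open>z j\<close> and
    \<open>z (Suc j)\<close>, so the series telescopes to \<open>z 0 = x\<close>.\<close>
  then have "(\<lambda>j. c * z j) sums (x - 0)"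
    using telescope_sums'[of z 0] by (simp add: z_Suc) (simp add: z_def)
  then have "x = c * suminf z"
    using sums_unique2[OF _ bounded_linear.sums[OF bounded_linear_mult_right summable_sums[OF sz]], of c x]
    by simp
  moreover have "suminf z \<in> N"
    by (rule closed_sequentially[OF N(1) _ summable_LIMSEQ[OF sz]]) (intro subspace_sum[OF N(2)] zN)
  ultimately show ?thesis using c(1) by blast
qed

text \<open>A Cohen-type factorization in which membership of \<open>x * x\<^sup>\<star>\<close> in
  \<open>C\<close> replaces an approximate unit of \<open>C\<close>. It is used for \<open>M\<close>
  over its ideal, and for \<open>P m\<close> in \<open>B\<close> over the closure of the image of
  \<tau>.\<close>

lemma factorization:
  fixes x :: "'a::cstar_algebra"
  assumes C: "closed_subalgebra C" "x * x\<^sup>\<star> \<in> C"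
    and N: "closed N" "subspace N" "x \<in> N" "\<And>c n. c \<in> C \<Longrightarrow> n \<in> N \<Longrightarrow> c * n \<in> N"
  shows "\<exists>c\<in>C. \<exists>n\<in>N. x = c * n"
proof -
  let ?y = "inverse (norm x) *\<^sub>R x"
  have "?y * ?y\<^sup>\<star> \<in> C" using C by (simp add: adj_scaleR closed_subalgebra_def subspace_scale)
  moreover have "norm ?y \<le> 1" by (cases "x = 0") auto
  ultimately obtain c n where "c \<in> C" "n \<in> N" "?y = c * n"
    using factorization_contraction[OF C(1) _ N(1,2) subspace_scale[OF N(2,3)] N(4)] by metis
  moreover from this have "x = c * (norm x *\<^sub>R n)"
    unfolding mult_scaleR_right by (metis norm_eq_zero scaleR_right_imp_eq divideR_right scaleR_zero_left)
  ultimately show ?thesis using subspace_scale[OF N(2)] by blast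
qed

section \<open>Square roots of central positive multipliers\<close>

lemma multiplier_algebraD:
  assumes "\<mu> \<in> multiplier_algebra I"
  shows "fst \<mu> \<in> I \<rightarrow>\<^sub>E I" "snd \<mu> \<in> I \<rightarrow>\<^sub>E I"
    "bounded_clinear_on I (fst \<mu>)" "bounded_clinear_on I (snd \<mu>)"
    "x \<in> I \<Longrightarrow> fst \<mu> x \<in> I" "x \<in> I \<Longrightarrow> snd \<mu> x \<in> I"
    "x \<in> I \<Longrightarrow> y \<in> I \<Longrightarrow> fst \<mu> (x * y) = fst \<mu> x * y"
    "x \<in> I \<Longrightarrow> y \<in> I \<Longrightarrow> snd \<mu> (x * y) = x * snd \<mu> y"
    "x \<in> I \<Longrightarrow> y \<in> I \<Longrightarrow> x * fst \<mu> y = snd \<mu> x * y"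
  using assms by (auto simp: multiplier_algebra_def)

lemma eq_if_mult_right_eq:
  assumes "closed_star_subalgebra I" "x \<in> I" "y \<in> I" "\<And>w. w \<in> I \<Longrightarrow> x * w = y * w"
  shows "x = (y :: 'a::cstar_algebra)"
proof -
  have "(x - y)\<^sup>\<star> \<in> I"
    using assms(1-3) by (auto simp: closed_star_subalgebra_def cvec.subspace_diff)
  from assms(4)[OF this] have "(x - y) * (x - y)\<^sup>\<star> = 0" by (simp add: left_diff_distrib)
  then have "norm (x - y) = 0" by (metis norm_mult_adj norm_zero power_eq_0_iff)
  then show ?thesis by simp
qed

text \<open>The left centralizer determines the right one through
  \<open>snd \<mu> x * w = x * fst \<mu> w\<close>.\<close>

lemma multiplier_eqI:
  assumes "closed_star_subalgebra I" "\<mu> \<in> multiplier_algebra I" "\<nu> \<in> multiplier_algebra I"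
    "\<And>x. x \<in> I \<Longrightarrow> fst \<mu> x = fst \<nu> x"
  shows "\<mu> = \<nu>"
proof (rule prod_eqI)
  show "fst \<mu> = fst \<nu>"
    using multiplier_algebraD(1)[OF assms(2)] multiplier_algebraD(1)[OF assms(3)] assms(4)
    by (rule PiE_ext)
  have "snd \<mu> x = snd \<nu> x" if "x \<in> I" for x
  proof (rule eq_if_mult_right_eq[OF assms(1)])
    show "snd \<mu> x \<in> I" "snd \<nu> x \<in> I"
      using multiplier_algebraD(6)[OF assms(2) that] multiplier_algebraD(6)[OF assms(3) that] .
    show "snd \<mu> x * w = snd \<nu> x * w" if "w \<in> I" for w
      using multiplier_algebraD(9)[OF assms(2) \<open>x \<in> I\<close> that]
        multiplier_algebraD(9)[OF assms(3) \<open>x \<in> I\<close> that] assms(4)[OF that] by simp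
  qed
  then show "snd \<mu> = snd \<nu>"
    by (rule PiE_ext[OF multiplier_algebraD(2)[OF assms(2)] multiplier_algebraD(2)[OF assms(3)]])
qed

lemma bounded_clinear_on_compose:
  assumes "bounded_clinear_on I f" "bounded_clinear_on I g" "g \<in> I \<rightarrow> I" "csubspace I"
  shows "bounded_clinear_on I (compose I f g)"
proof -
  obtain K L where K: "\<And>x. x \<in> I \<Longrightarrow> norm (f x) \<le> K * norm x"
    and L: "\<And>x. x \<in> I \<Longrightarrow> norm (g x) \<le> L * norm x"
    using assms(1,2) unfolding bounded_clinear_on_def by blast
  have "norm (f (g x)) \<le> (\<bar>K\<bar> * L) * norm x" if "x \<in> I" for x
  proof -
    have "norm (f (g x)) \<le> K * norm (g x)" using K that assms(3) by blast
    also have "\<dots> \<le> \<bar>K\<bar> * norm (g x)" by (intro mult_right_mono) auto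
    also have "\<dots> \<le> \<bar>K\<bar> * (L * norm x)" by (intro mult_left_mono L that) auto
    finally show ?thesis by (simp add: mult.assoc)
  qed
  then have "\<exists>K. \<forall>x\<in>I. norm (compose I f g x) \<le> K * norm x" by (auto simp: compose_eq)
  moreover have "clinear_on I (compose I f g)"
    using assms by (auto simp: bounded_clinear_on_def clinear_on_def compose_eq Pi_iff
        cvec.subspace_add cvec.subspace_scale)
  ultimately show ?thesis by (simp add: bounded_clinear_on_def)
qed

lemma bounded_clinear_on_adj:
  assumes "bounded_clinear_on I f" "csubspace I" "\<And>x. x \<in> I \<Longrightarrow> x\<^sup>\<star> \<in> I"
  shows "bounded_clinear_on I (\<lambda>x\<in>I. (f (x\<^sup>\<star>))\<^sup>\<star>)"
proof -
  obtain K where K: "\<And>x. x \<in> I \<Longrightarrow> norm (f x) \<le> K * norm x"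
    using assms(1) unfolding bounded_clinear_on_def by blast
  have "\<exists>K. \<forall>x\<in>I. norm ((\<lambda>x\<in>I. (f (x\<^sup>\<star>))\<^sup>\<star>) x) \<le> K * norm x"
    using K[OF assms(3)] by (intro exI[of _ K]) simp
  moreover have "clinear_on I (\<lambda>x\<in>I. (f (x\<^sup>\<star>))\<^sup>\<star>)"
    using assms by (auto simp: bounded_clinear_on_def clinear_on_def adj_add adj_scaleC
        cvec.subspace_add cvec.subspace_scale)
  ultimately show ?thesis by (simp add: bounded_clinear_on_def)
qed

lemma mult_times_in:
  assumes I: "closed_star_subalgebra I" and "\<mu> \<in> multiplier_algebra I" "\<nu> \<in> multiplier_algebra I"
  shows "mult_times I \<mu> \<nu> \<in> multiplier_algebra I"
proof -
  have "csubspace I" "\<And>x y. x \<in> I \<Longrightarrow> y \<in> I \<Longrightarrow> x * y \<in> I"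
    using I by (auto simp: closed_star_subalgebra_def)
  then show ?thesis
    using multiplier_algebraD[OF assms(2)] multiplier_algebraD[OF assms(3)]
    unfolding mult_times_def multiplier_algebra_def
    by (auto simp: bounded_clinear_on_compose compose_eq extensional_arb[OF compose_extensional])
qed

lemma mult_adj_in:
  assumes I: "closed_star_subalgebra I" and \<mu>: "\<mu> \<in> multiplier_algebra I"
  shows "mult_adj I \<mu> \<in> multiplier_algebra I"
proof -
  have I: "csubspace I" "\<And>x y. x \<in> I \<Longrightarrow> y \<in> I \<Longrightarrow> x * y \<in> I" "\<And>x. x \<in> I \<Longrightarrow> x\<^sup>\<star> \<in> I"
    using I by (auto simp: closed_star_subalgebra_def)
  have "x * (snd \<mu> (y\<^sup>\<star>))\<^sup>\<star> = (fst \<mu> (x\<^sup>\<star>))\<^sup>\<star> * y" if "x \<in> I" "y \<in> I" for x y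
    using multiplier_algebraD(9)[OF \<mu>, of "y\<^sup>\<star>" "x\<^sup>\<star>"] that I(3)
    by (metis adj_adj adj_mult)
  then show ?thesis
    using multiplier_algebraD[OF \<mu>] I
    unfolding mult_adj_def multiplier_algebra_def
    by (auto intro!: bounded_clinear_on_adj simp: adj_mult adj_adj)
qed

section \<open>Multipliers as families of operators\<close>

definition multiplier_op :: "'a::cstar_algebra set \<Rightarrow> 'a multiplier \<Rightarrow> 'a opfam" where
  "multiplier_op I \<mu> = opfam_at I (fst \<mu>)"

text \<open>The right centralizer is recovered from the adjoint: \<mu> acts on \<open>x\<close> from
  the right as the adjoint of \<open>\<mu>\<^sup>\<star>\<close> applied to
  \<open>x\<^sup>\<star>\<close>.\<close>

definition op_multiplier :: "'a::cstar_algebra set \<Rightarrow> 'a opfam \<Rightarrow> 'a multiplier" where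
  "op_multiplier I f = (\<lambda>x\<in>I. Rep_opfam f I x, \<lambda>x\<in>I. (Rep_opfam (f\<^sup>\<star>) I (x\<^sup>\<star>))\<^sup>\<star>)"

lemma in_module_closed_star_subalgebra:
  "closed_star_subalgebra I \<Longrightarrow> in_module I x \<longleftrightarrow> x \<in> I"
  by (auto simp: in_module_def closed_star_subalgebra_def)

text \<open>Adjointability is the double centralizer identity with one argument replaced by its
  adjoint.\<close>

lemma multiplier_adjointable:
  assumes I: "closed_star_subalgebra I" and \<mu>: "\<mu> \<in> multiplier_algebra I"
  shows "adjointable_on I (fst \<mu>) (fst (mult_adj I \<mu>))"
proof -
  have star: "x\<^sup>\<star> \<in> I" if "x \<in> I" for x using I that by (auto simp: closed_star_subalgebra_def)
  have "(fst \<mu> x)\<^sup>\<star> * y = x\<^sup>\<star> * (snd \<mu> (y\<^sup>\<star>))\<^sup>\<star>" if "x \<in> I" "y \<in> I" for x y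
    using multiplier_algebraD(9)[OF \<mu>, of "y\<^sup>\<star>" x] that star by (metis adj_adj adj_mult)
  then show ?thesis
    using I multiplier_algebraD[OF \<mu>] star multiplier_algebraD(5)[OF mult_adj_in[OF I \<mu>]]
    unfolding adjointable_on_def
    by (auto simp: mult_adj_def closed_star_subalgebra_def bounded_clinear_on_def)
qed

lemma Rep_multiplier_op:
  assumes "closed_star_subalgebra I" "\<mu> \<in> multiplier_algebra I"
  shows "Rep_opfam (multiplier_op I \<mu>) = (\<lambda>E x. if E = I \<and> x \<in> I then fst \<mu> x else 0)"
  unfolding multiplier_op_def Rep_opfam_at[OF multiplier_adjointable[OF assms]]
  using in_module_closed_star_subalgebra[OF assms(1)] by (intro ext) (simp cong: conj_cong)

lemma multiplier_op_times:
  assumes "closed_star_subalgebra I" "\<mu> \<in> multiplier_algebra I" "\<nu> \<in> multiplier_algebra I"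
  shows "multiplier_op I (mult_times I \<mu> \<nu>) = multiplier_op I \<mu> * multiplier_op I \<nu>"
proof (rule opfam_eqI)
  fix E and x :: 'a assume "in_module E x"
  show "Rep_opfam (multiplier_op I (mult_times I \<mu> \<nu>)) E x =
      Rep_opfam (multiplier_op I \<mu> * multiplier_op I \<nu>) E x"
  proof (cases "E = I \<and> x \<in> I")
    case True
    then show ?thesis
      using multiplier_algebraD(5)[OF assms(3)]
      by (simp add: Rep_multiplier_op assms mult_times_in times_opfam.rep_eq)
        (simp add: mult_times_def compose_eq)
  next
    case False
    then show ?thesis
      unfolding times_opfam.rep_eq Rep_multiplier_op[OF assms(1) mult_times_in[OF assms(1-3)]]
      by (auto simp: Rep_multiplier_op[OF assms(1,3)] Rep_opfam_zero_arg)
  qed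
qed

lemma multiplier_op_adj:
  assumes "closed_star_subalgebra I" "\<mu> \<in> multiplier_algebra I"
  shows "multiplier_op I (mult_adj I \<mu>) = (multiplier_op I \<mu>)\<^sup>\<star>"
  unfolding multiplier_op_def by (rule adj_opfam_at[OF multiplier_adjointable[OF assms], symmetric])

lemma multiplier_op_inject:
  assumes "closed_star_subalgebra I" "\<mu> \<in> multiplier_algebra I" "\<nu> \<in> multiplier_algebra I"
    "multiplier_op I \<mu> = multiplier_op I \<nu>"
  shows "\<mu> = \<nu>"
  by (rule multiplier_eqI[OF assms(1-3)])
    (metis (full_types) Rep_multiplier_op assms)

text \<open>The range of \<open>multiplier_op I\<close>. Being a closed subalgebra, it contains the
  roots of its elements, although in general not the unit.\<close>

definition concentrated_at :: "'a::cstar_algebra set \<Rightarrow> 'a opfam set" where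
  "concentrated_at I = {f. \<forall>E x. E \<noteq> I \<longrightarrow> Rep_opfam f E x = 0}"

lemma closed_subalgebra_concentrated_at: "closed_subalgebra (concentrated_at I)"
proof -
  have "closed {f. Rep_opfam f E x = 0}" for E x
    by (intro closed_Collect_eq linear_continuous_on bounded_linear_Rep_opfam continuous_on_const)
  then have "closed (concentrated_at I)"
    unfolding concentrated_at_def by (intro closed_Collect_all closed_Collect_imp) auto
  then show ?thesis
    by (auto simp: closed_subalgebra_def subspace_def concentrated_at_def zero_opfam.rep_eq
        plus_opfam.rep_eq scaleR_opfam.rep_eq times_opfam.rep_eq)
qed

text \<open>Adjointable operators on \<open>I\<close> commute with right multiplication by elements
  of \<open>I\<close>, since both sides have the same inner products.\<close>

lemma op_multiplier_in:
  assumes I: "closed_star_subalgebra I"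
  shows "op_multiplier I f \<in> multiplier_algebra I"
proof -
  note im = in_module_closed_star_subalgebra[OF I]
  have I': "csubspace I" "\<And>x y. x \<in> I \<Longrightarrow> y \<in> I \<Longrightarrow> x * y \<in> I" "\<And>x. x \<in> I \<Longrightarrow> x\<^sup>\<star> \<in> I"
    using I by (auto simp: closed_star_subalgebra_def)
  have Rep_in: "Rep_opfam g I x \<in> I" if "x \<in> I" for g x
    using Rep_opfam_in_module[of I x g] that by (simp add: im)
  have adj: "(Rep_opfam g I x)\<^sup>\<star> * y = x\<^sup>\<star> * Rep_opfam (g\<^sup>\<star>) I y" if "x \<in> I" "y \<in> I" for g x y
    using Rep_opfam_adjoint[of I x y g] that by (simp add: im adj_opfam_def)
  have mult: "Rep_opfam g I (x * y) = Rep_opfam g I x * y" if "x \<in> I" "y \<in> I" for g x y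
  proof (rule in_module_eqI)
    show "in_module I (Rep_opfam g I (x * y))" "in_module I (Rep_opfam g I x * y)"
      using that I' Rep_in by (simp_all add: im)
    fix w assume "in_module I w"
    then show "(Rep_opfam g I (x * y))\<^sup>\<star> * w = (Rep_opfam g I x * y)\<^sup>\<star> * w"
      using that I' adj by (simp add: im adj_mult mult.assoc)
  qed
  have bcl: "bounded_clinear_on I (\<lambda>x\<in>I. Rep_opfam g I x)" for g
    unfolding bounded_clinear_on_def
  proof
    show "clinear_on I (\<lambda>x\<in>I. Rep_opfam g I x)"
      using I' by (simp add: clinear_on_def Rep_opfam_add Rep_opfam_scaleC im
          cvec.subspace_add cvec.subspace_scale)
    show "\<exists>K. \<forall>x\<in>I. norm ((\<lambda>x\<in>I. Rep_opfam g I x) x) \<le> K * norm x"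
      by (intro exI[of _ "norm g"]) (simp add: norm_Rep_opfam)
  qed
  have eq: "(\<lambda>x\<in>I. (Rep_opfam (f\<^sup>\<star>) I (x\<^sup>\<star>))\<^sup>\<star>)
      = (\<lambda>x\<in>I. ((\<lambda>x\<in>I. Rep_opfam (f\<^sup>\<star>) I x) (x\<^sup>\<star>))\<^sup>\<star>)"
    using I' by auto
  have "bounded_clinear_on I (\<lambda>x\<in>I. (Rep_opfam (f\<^sup>\<star>) I (x\<^sup>\<star>))\<^sup>\<star>)"
    unfolding eq by (rule bounded_clinear_on_adj[OF bcl I'(1,3)])
  moreover have "x * Rep_opfam f I y = (Rep_opfam (f\<^sup>\<star>) I (x\<^sup>\<star>))\<^sup>\<star> * y" if "x \<in> I" "y \<in> I" for x y
    using adj[of "x\<^sup>\<star>" y "f\<^sup>\<star>"] that I' by (simp add: adj_adj)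
  ultimately show ?thesis
    using bcl I' Rep_in mult unfolding op_multiplier_def multiplier_algebra_def
    by (auto simp: adj_mult adj_adj)
qed

lemma multiplier_op_op_multiplier:
  assumes "closed_star_subalgebra I" "f \<in> concentrated_at I"
  shows "multiplier_op I (op_multiplier I f) = f"
proof (rule opfam_eqI)
  fix E and x :: 'a assume "in_module E x"
  then show "Rep_opfam (multiplier_op I (op_multiplier I f)) E x = Rep_opfam f E x"
    unfolding Rep_multiplier_op[OF assms(1) op_multiplier_in[OF assms(1)]]
    using assms in_module_closed_star_subalgebra[OF assms(1), of x]
    by (cases "E = I") (auto simp: op_multiplier_def concentrated_at_def)
qed

text \<open>The root is formed among the families and pulled back. Uniqueness is part of the work
  because \<open>mult_sqrt\<close> is a definite description; centrality holds because the root lies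
  in the commutant of every multiplier.\<close>

lemma mult_sqrt_properties:
  assumes I: "closed_star_subalgebra I" and \<tau>: "\<tau> \<in> multiplier_algebra I"
    and central: "mult_central I \<tau>" and positive: "mult_positive I \<tau>"
  shows "mult_sqrt I \<tau> \<in> multiplier_algebra I" "mult_positive I (mult_sqrt I \<tau>)"
    "mult_times I (mult_sqrt I \<tau>) (mult_sqrt I \<tau>) = \<tau>" "mult_central I (mult_sqrt I \<tau>)"
proof -
  note hom = multiplier_op_times[OF I] multiplier_op_adj[OF I] mult_adj_in[OF I] mult_times_in[OF I]
  note inj = multiplier_op_inject[OF I]
  let ?T = "multiplier_op I"
  obtain v where v: "v \<in> multiplier_algebra I" "\<tau> = mult_times I (mult_adj I v) v"
    using positive by (auto simp: mult_positive_def)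
  have "?T \<tau> = (?T v)\<^sup>\<star> * ?T v" using v by (simp add: hom)
  moreover have "?T \<tau> * ?T \<nu> = ?T \<nu> * ?T \<tau>" if "\<nu> \<in> multiplier_algebra I" for \<nu>
    using that central \<tau> by (simp add: mult_central_def flip: hom(1))
  note comm = this
  \<comment> \<open>Centrality of \<tau> supplies the commutation with \<open>?T v\<close>.\<close>
  ultimately have "pos (?T \<tau>)"
    using comm[OF v(1)] by (intro pos_adj_mult_self_if_commute)
  then obtain s where s: "pos s" "s * s = ?T \<tau>"
    "\<And>C. closed_subalgebra C \<Longrightarrow> ?T \<tau> \<in> C \<Longrightarrow> s \<in> C"
    using pos_obtain_sqrt by blast
  \<comment> \<open>A fourth root of \<tau>, needed to exhibit the square root in the form that
    \<open>mult_positive\<close> demands.\<close>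
  obtain b where b: "pos b" "b * b = s" "\<And>C. closed_subalgebra C \<Longrightarrow> s \<in> C \<Longrightarrow> b \<in> C"
    using pos_obtain_sqrt[OF s(1)] by blast
  have "?T \<tau> \<in> concentrated_at I"
    by (simp add: concentrated_at_def Rep_multiplier_op[OF I \<tau>])
  then have sI: "s \<in> concentrated_at I" by (rule s(3)[OF closed_subalgebra_concentrated_at])
  then have bI: "b \<in> concentrated_at I" by (rule b(3)[OF closed_subalgebra_concentrated_at])
  define \<sigma> where "\<sigma> = op_multiplier I s"
  define \<beta> where "\<beta> = op_multiplier I b"
  have T: "?T \<sigma> = s" "?T \<beta> = b"
    unfolding \<sigma>_def \<beta>_def by (simp_all add: multiplier_op_op_multiplier[OF I] sI bI)
  have M: "\<sigma> \<in> multiplier_algebra I" "\<beta> \<in> multiplier_algebra I"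
    unfolding \<sigma>_def \<beta>_def by (simp_all add: op_multiplier_in[OF I])
  have "\<sigma> = mult_times I (mult_adj I \<beta>) \<beta>"
    by (rule inj) (simp_all add: M hom T b pos_sa)
  then have \<sigma>pos: "mult_positive I \<sigma>" using M by (auto simp: mult_positive_def)
  have \<sigma>sq: "mult_times I \<sigma> \<sigma> = \<tau>" by (rule inj) (simp_all add: M hom T s \<tau>)
  have "mult_sqrt I \<tau> = \<sigma>"
    unfolding mult_sqrt_def
  proof (rule the_equality)
    show "\<sigma> \<in> multiplier_algebra I \<and> mult_positive I \<sigma> \<and> mult_times I \<sigma> \<sigma> = \<tau>"
      using M \<sigma>pos \<sigma>sq by simp
    fix \<rho> assume \<rho>: "\<rho> \<in> multiplier_algebra I \<and> mult_positive I \<rho> \<and> mult_times I \<rho> \<rho> = \<tau>"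
    then obtain w where w: "w \<in> multiplier_algebra I" "\<rho> = mult_times I (mult_adj I w) w"
      by (auto simp: mult_positive_def)
    have "?T \<rho> = s"
    proof (rule pos_sqrt_unique[OF s(1)])
      show "\<And>C. closed_subalgebra C \<Longrightarrow> s * s \<in> C \<Longrightarrow> s \<in> C" using s by simp
      show "?T \<rho> = (?T w)\<^sup>\<star> * ?T w" using w by (simp add: hom)
      show "?T \<rho> * ?T \<rho> = s * s" using \<rho> s by (simp flip: hom(1))
    qed
    then show "\<rho> = \<sigma>" using \<rho> M T by (intro inj) auto
  qed
  moreover have "mult_central I \<sigma>"
    unfolding mult_central_def
  proof
    fix \<nu> assume \<nu>: "\<nu> \<in> multiplier_algebra I"
    have "s \<in> {x. ?T \<nu> * x = x * ?T \<nu>}"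
      by (rule s(3)[OF closed_subalgebra_commutant]) (simp add: comm[OF \<nu>])
    then show "mult_times I \<sigma> \<nu> = mult_times I \<nu> \<sigma>"
      by (intro inj) (simp_all add: M \<nu> hom T)
  qed
  ultimately show "mult_sqrt I \<tau> \<in> multiplier_algebra I" "mult_positive I (mult_sqrt I \<tau>)"
    "mult_times I (mult_sqrt I \<tau>) (mult_sqrt I \<tau>) = \<tau>" "mult_central I (mult_sqrt I \<tau>)"
    using M \<sigma>pos \<sigma>sq by simp_all
qed

section \<open>Slices\<close>

lemma closure_LIMSEQ: "(\<And>n. f n \<in> S) \<Longrightarrow> f \<longlonglongrightarrow> x \<Longrightarrow> x \<in> closure S"
  for S :: "'a::metric_space set"
  unfolding closure_sequential by blast

lemma csubspace_closure:
  assumes "csubspace (S :: 'a::cstar_algebra set)" shows "csubspace (closure S)"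
  unfolding cvec.subspace_def
proof (intro conjI ballI allI)
  show "0 \<in> closure S" using cvec.subspace_0[OF assms] closure_subset by blast
  fix x assume "x \<in> closure S"
  then obtain f where f: "\<And>n. f n \<in> S" "f \<longlonglongrightarrow> x" unfolding closure_sequential by blast
  show "c *\<^sub>C x \<in> closure S" for c
    by (rule closure_LIMSEQ[OF cvec.subspace_scale[OF assms f(1)] tendsto_scaleC[OF f(2)]])
  fix y assume "y \<in> closure S"
  then obtain g where g: "\<And>n. g n \<in> S" "g \<longlonglongrightarrow> y" unfolding closure_sequential by blast
  show "x + y \<in> closure S"
    by (rule closure_LIMSEQ[OF cvec.subspace_add[OF assms f(1) g(1)] tendsto_add[OF f(2) g(2)]])
qed

lemma closed_csubspace_vimage:
  assumes "bounded_linear f" "closed S" "csubspace S" "\<And>c x. f x \<in> S \<Longrightarrow> f (c *\<^sub>C x) \<in> S"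
  shows "closed (f -` S)" "csubspace (f -` S)"
proof -
  show "closed (f -` S)"
    using assms(1,2) by (intro continuous_closed_vimage) (auto intro: linear_continuous_at)
  show "csubspace (f -` S)"
    using assms linear_add[OF bounded_linear.linear[OF assms(1)]]
      linear_0[OF bounded_linear.linear[OF assms(1)]]
    unfolding cvec.subspace_def by simp
qed

lemma conditional_expectation_bounded_linear:
  assumes "conditional_expectation B P" shows "bounded_linear P"
proof (rule bounded_linear_intro[where K = 1])
  fix x y :: 'a and r :: real
  show "P (x + y) = P x + P y"
    using assms by (simp add: conditional_expectation_def clinear_on_def)
  show "P (r *\<^sub>R x) = r *\<^sub>R P x"
    using assms unfolding scaleC_of_real[symmetric]
    by (simp add: conditional_expectation_def clinear_on_def)
  show "norm (P x) \<le> norm x * 1"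
    using assms by (simp add: conditional_expectation_def)
qed

lemma positive_element_sa: "positive_element x \<Longrightarrow> x\<^sup>\<star> = x"
  by (auto simp: positive_element_def adj_mult adj_adj)

text \<open>Positivity of \<open>P\<close> makes \<open>P (u\<^sup>\<star> * u)\<close>
  self-adjoint. Polarization needs a second factor in place of the missing unit; it is an element
  \<open>e\<close> of the approximate unit, removed in the limit.\<close>

lemma conditional_expectation_adj:
  assumes P: "conditional_expectation B P" and au: "contains_approximate_unit B"
  shows "P (x\<^sup>\<star>) = (P x)\<^sup>\<star>"
proof -
  have lin: "P (u + v) = P u + P v" "P (c *\<^sub>C u) = c *\<^sub>C P u" for u v c
    using P by (simp_all add: conditional_expectation_def clinear_on_def)
  note diff = linear_diff[OF bounded_linear.linear[OF conditional_expectation_bounded_linear[OF P]]]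
  have sa: "(P (u\<^sup>\<star> * u))\<^sup>\<star> = P (u\<^sup>\<star> * u)" for u
    using P positive_element_sa unfolding conditional_expectation_def positive_element_def by metis
  have pol: "P (x\<^sup>\<star> * e) = (P (e\<^sup>\<star> * x))\<^sup>\<star>" for e
  proof -
    define a where "a = P (e\<^sup>\<star> * x)"
    define b where "b = P (x\<^sup>\<star> * e)"
    have "(e + x)\<^sup>\<star> * (e + x) = e\<^sup>\<star> * e + (e\<^sup>\<star> * x + x\<^sup>\<star> * e) + x\<^sup>\<star> * x"
      by (simp add: adj_add algebra_simps)
    then have 1: "a\<^sup>\<star> + b\<^sup>\<star> = a + b"
      using sa[of "e + x"] sa[of e] sa[of x] by (simp add: lin adj_add a_def b_def)
    have "(e + \<i> *\<^sub>C x)\<^sup>\<star> * (e + \<i> *\<^sub>C x)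
        = e\<^sup>\<star> * e + (\<i> *\<^sub>C (e\<^sup>\<star> * x) + (-\<i>) *\<^sub>C (x\<^sup>\<star> * e)) + x\<^sup>\<star> * x"
      by (simp add: adj_add adj_scaleC distrib_left distrib_right left_diff_distrib
          scaleC_diff_right mult_scaleC_left mult_scaleC_right scaleC_scaleC)
    then have "(\<i> *\<^sub>C a + (-\<i>) *\<^sub>C b)\<^sup>\<star> = \<i> *\<^sub>C a + (-\<i>) *\<^sub>C b"
      using sa[of "e + \<i> *\<^sub>C x"] sa[of e] sa[of x] by (simp add: lin diff adj_add a_def b_def)
    then have "\<i> *\<^sub>C (b\<^sup>\<star> - a\<^sup>\<star>) = \<i> *\<^sub>C (a - b)"
      by (simp add: adj_diff adj_scaleC scaleC_diff_right)
    then have "(-\<i>) *\<^sub>C \<i> *\<^sub>C (b\<^sup>\<star> - a\<^sup>\<star>) = (-\<i>) *\<^sub>C \<i> *\<^sub>C (a - b)" by simp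
    then have "b\<^sup>\<star> - a\<^sup>\<star> = a - b" unfolding scaleC_scaleC by simp
    then have 2: "a\<^sup>\<star> - b\<^sup>\<star> = b - a" by (metis minus_diff_eq)
    have "2 *\<^sub>R a\<^sup>\<star> = (a\<^sup>\<star> + b\<^sup>\<star>) + (a\<^sup>\<star> - b\<^sup>\<star>)" by (simp add: scaleR_2)
    also have "\<dots> = 2 *\<^sub>R b" unfolding 1 2 by (simp add: scaleR_2)
    finally show ?thesis by (simp add: a_def b_def)
  qed
  obtain F where F: "F \<noteq> bot" "\<forall>\<^sub>F e in F. e \<in> B \<and> positive_element e \<and> norm e \<le> 1"
    "\<And>a :: 'a. ((\<lambda>e. e * a) \<longlongrightarrow> a) F" "\<And>a :: 'a. ((\<lambda>e. a * e) \<longlongrightarrow> a) F"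
    using au unfolding contains_approximate_unit_def by blast
  note tP = bounded_linear.tendsto[OF conditional_expectation_bounded_linear[OF P]]
  have "((\<lambda>e. (P (e * x))\<^sup>\<star>) \<longlongrightarrow> (P x)\<^sup>\<star>) F"
    by (intro tendsto_adj tP F)
  moreover have "\<forall>\<^sub>F e in F. (P (e * x))\<^sup>\<star> = P (x\<^sup>\<star> * e)"
    using F(2) by (rule eventually_mono) (use pol positive_element_sa in force)
  ultimately have "((\<lambda>e. P (x\<^sup>\<star> * e)) \<longlongrightarrow> (P x)\<^sup>\<star>) F"
    by (rule Lim_transform_eventually)
  moreover have "((\<lambda>e. P (x\<^sup>\<star> * e)) \<longlongrightarrow> P (x\<^sup>\<star>)) F"
    by (intro tP F)
  ultimately show ?thesis using tendsto_unique[OF F(1)] by blast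
qed

text \<open>An approximate unit in the middle of \<open>m * b * m\<^sup>\<star>\<close> gives the
  case \<open>m = n\<close>; polarization gives the rest. \<open>M\<close> is any subspace, so that
  the adjoints of a slice are covered too.\<close>

lemma mult_adj_in_if_normalizes:
  assumes B: "closed_star_subalgebra B" "contains_approximate_unit B" and M: "csubspace M"
    and norm: "\<And>m b. m \<in> M \<Longrightarrow> b \<in> B \<Longrightarrow> m * b * m\<^sup>\<star> \<in> B"
    and "m \<in> M" "n \<in> M"
  shows "m * n\<^sup>\<star> \<in> B"
proof -
  have B': "closed B" "csubspace B" using B by (auto simp: closed_star_subalgebra_def)
  obtain F where F: "F \<noteq> bot" "\<forall>\<^sub>F e in F. e \<in> B \<and> positive_element e \<and> norm e \<le> 1"
    "\<And>a :: 'a. ((\<lambda>e. a * e) \<longlongrightarrow> a) F"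
    using B(2) unfolding contains_approximate_unit_def by blast
  have sq: "k * k\<^sup>\<star> \<in> B" if "k \<in> M" for k
  proof (rule Lim_in_closed_set[OF B'(1) _ F(1)])
    show "\<forall>\<^sub>F e in F. k * e * k\<^sup>\<star> \<in> B"
      using F(2) by (rule eventually_mono) (use norm that in blast)
    show "((\<lambda>e. k * e * k\<^sup>\<star>) \<longlongrightarrow> k * k\<^sup>\<star>) F" by (intro tendsto_intros F)
  qed
  let ?a = "m * n\<^sup>\<star>" and ?b = "n * m\<^sup>\<star>"
  have eq: "?a + ?b = (m + n) * (m + n)\<^sup>\<star> - m * m\<^sup>\<star> - n * n\<^sup>\<star>"
    "(-\<i>) *\<^sub>C ?a + \<i> *\<^sub>C ?b = (m + \<i> *\<^sub>C n) * (m + \<i> *\<^sub>C n)\<^sup>\<star> - m * m\<^sup>\<star> - n * n\<^sup>\<star>"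
    by (simp_all add: adj_add adj_scaleC distrib_left distrib_right right_diff_distrib
        scaleC_add_right scaleC_diff_right mult_scaleC_left mult_scaleC_right scaleC_scaleC)
  have "m + n \<in> M" "m + \<i> *\<^sub>C n \<in> M"
    using assms(5,6) M by (simp_all add: cvec.subspace_add cvec.subspace_scale)
  then have ab: "?a + ?b \<in> B" "(-\<i>) *\<^sub>C ?a + \<i> *\<^sub>C ?b \<in> B"
    unfolding eq by (simp_all only: cvec.subspace_diff[OF B'(2)] sq assms(5,6))
  \<comment> \<open>In this combination the two multiples of \<open>?b\<close> cancel and those of
    \<open>?a\<close> add up.\<close>
  have "(1/2) *\<^sub>C ((?a + ?b) + \<i> *\<^sub>C ((-\<i>) *\<^sub>C ?a + \<i> *\<^sub>C ?b)) \<in> B"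
    by (rule cvec.subspace_scale[OF B'(2)
          cvec.subspace_add[OF B'(2) ab(1) cvec.subspace_scale[OF B'(2) ab(2)]]])
  also have "(1/2) *\<^sub>C ((?a + ?b) + \<i> *\<^sub>C ((-\<i>) *\<^sub>C ?a + \<i> *\<^sub>C ?b)) = (1/2) *\<^sub>C ?a + (1/2) *\<^sub>C ?a"
    by (simp add: scaleC_add_right scaleC_diff_right scaleC_scaleC)
  also have "\<dots> = ?a" by (simp flip: scaleC_add_left)
  finally show ?thesis .
qed

section \<open>The ideal of a slice\<close>

locale slice_in =
  fixes B M :: "'a::cstar_algebra set"
  assumes B: "closed_star_subalgebra B"
    and approx_unit: "contains_approximate_unit B"
    and slice: "slice B M"
begin

abbreviation "I \<equiv> slice_ideal M"

lemma closed_B: "closed B" and csubspace_B: "csubspace B"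
  and B_mult: "x \<in> B \<Longrightarrow> y \<in> B \<Longrightarrow> x * y \<in> B" and B_adj: "x \<in> B \<Longrightarrow> x\<^sup>\<star> \<in> B"
  using B by (auto simp: closed_star_subalgebra_def)

lemma closed_M: "closed M" and csubspace_M: "csubspace M"
  and B_M: "b \<in> B \<Longrightarrow> m \<in> M \<Longrightarrow> b * m \<in> M" and M_B: "m \<in> M \<Longrightarrow> b \<in> B \<Longrightarrow> m * b \<in> M"
  using slice by (auto simp: slice_def)

lemma M_normalizes: "m \<in> M \<Longrightarrow> b \<in> B \<Longrightarrow> m * b * m\<^sup>\<star> \<in> B" "m \<in> M \<Longrightarrow> b \<in> B \<Longrightarrow> m\<^sup>\<star> * b * m \<in> B"
  using slice unfolding slice_def normalizer_def by blast+

lemma M_adj_in_B: "m \<in> M \<Longrightarrow> n \<in> M \<Longrightarrow> m * n\<^sup>\<star> \<in> B"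
  by (rule mult_adj_in_if_normalizes[OF B approx_unit csubspace_M M_normalizes(1)])

lemma adj_M_in_B: assumes "m \<in> M" "n \<in> M" shows "m\<^sup>\<star> * n \<in> B"
proof -
  have "csubspace {x. x\<^sup>\<star> \<in> M}"
    using csubspace_M by (simp add: cvec.subspace_def adj_add adj_scaleC)
  then have "m\<^sup>\<star> * (n\<^sup>\<star>)\<^sup>\<star> \<in> B"
  proof (rule mult_adj_in_if_normalizes[OF B approx_unit])
    show "x * b * x\<^sup>\<star> \<in> B" if "x \<in> {x. x\<^sup>\<star> \<in> M}" "b \<in> B" for x b
      using M_normalizes(2)[of "x\<^sup>\<star>" b] that by (simp add: adj_adj)
  qed (simp_all add: assms adj_adj)
  then show ?thesis by (simp add: adj_adj)
qed

lemma M_adj_in_I: "m \<in> M \<Longrightarrow> n \<in> M \<Longrightarrow> m * n\<^sup>\<star> \<in> I"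
  unfolding slice_ideal_def by (rule subsetD[OF closure_subset]) (auto intro: cvec.span_base)

lemma closed_I: "closed I"
  by (simp add: slice_ideal_def)

lemma csubspace_I: "csubspace I"
  unfolding slice_ideal_def by (intro csubspace_closure cvec.subspace_span)

text \<open>Induction principle for the ideal: the closure properties below are checked on the
  generators only.\<close>

lemma I_minimal:
  "closed S \<Longrightarrow> csubspace S \<Longrightarrow> (\<And>m n. m \<in> M \<Longrightarrow> n \<in> M \<Longrightarrow> m * n\<^sup>\<star> \<in> S) \<Longrightarrow> I \<subseteq> S"
  unfolding slice_ideal_def by (intro closure_minimal cvec.span_minimal) auto

lemma I_subset_B: "I \<subseteq> B"
  by (intro I_minimal closed_B csubspace_B M_adj_in_B)

lemma B_I: assumes "b \<in> B" "x \<in> I" shows "b * x \<in> I"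
proof -
  have "I \<subseteq> (\<lambda>x. b * x) -` I"
    using assms(1) csubspace_I closed_I
    by (intro I_minimal closed_csubspace_vimage bounded_linear_mult_right)
      (auto simp: mult_scaleC_right cvec.subspace_scale M_adj_in_I B_M simp flip: mult.assoc)
  then show ?thesis using assms by blast
qed

lemma adj_I: assumes "x \<in> I" shows "x\<^sup>\<star> \<in> I"
proof -
  have "I \<subseteq> (\<lambda>x. x\<^sup>\<star>) -` I"
    using csubspace_I closed_I
    by (intro I_minimal closed_csubspace_vimage bounded_linear_adj)
      (auto simp: adj_scaleC cvec.subspace_scale M_adj_in_I adj_mult adj_adj)
  then show ?thesis using assms by blast
qed

lemma I_B: "x \<in> I \<Longrightarrow> b \<in> B \<Longrightarrow> x * b \<in> I"
  by (metis B_I B_adj adj_I adj_adj adj_mult)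

text \<open>On generators, \<open>m * n\<^sup>\<star> * k\<close> is \<open>m\<close> times the
  element \<open>n\<^sup>\<star> * k\<close> of \<open>B\<close>.\<close>

lemma I_M: assumes "x \<in> I" "k \<in> M" shows "x * k \<in> M"
proof -
  have "I \<subseteq> (\<lambda>x. x * k) -` M"
    using assms(2) csubspace_M closed_M
    by (intro I_minimal closed_csubspace_vimage bounded_linear_mult_left)
      (auto simp: mult_scaleC_left cvec.subspace_scale M_B adj_M_in_B mult.assoc)
  then show ?thesis using assms by blast
qed

lemma closed_star_subalgebra_I: "closed_star_subalgebra I"
  using I_subset_B by (auto simp: closed_star_subalgebra_def closed_I csubspace_I adj_I B_I)

lemma closed_subalgebra_I: "closed_subalgebra I"
  using closed_star_subalgebra_I
  by (auto simp: closed_subalgebra_def closed_star_subalgebra_def csubspace_imp_subspace)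

lemma M_factor: assumes "m \<in> M" obtains a n where "a \<in> I" "n \<in> M" "m = a * n"
  using factorization[OF closed_subalgebra_I M_adj_in_I[OF assms assms] closed_M
      csubspace_imp_subspace[OF csubspace_M] assms I_M] by blast

text \<open>For \<open>d = x - y\<close> the test element \<open>d * d\<^sup>\<star>\<close> lies in
  the ideal and has square 0. Identities for \<open>slice_action\<close> are proved by this
  criterion.\<close>

lemma M_eqI:
  assumes "x \<in> M" "y \<in> M" "\<And>c. c \<in> I \<Longrightarrow> c * x = c * y"
  shows "x = y"
proof -
  define d where "d = x - y"
  have "d \<in> M" unfolding d_def using assms csubspace_M by (simp add: cvec.subspace_diff)
  then have "d * d\<^sup>\<star> * d = 0"
    using assms(3)[OF M_adj_in_I] by (simp add: d_def right_diff_distrib)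
  then have "(d * d\<^sup>\<star>) * (d * d\<^sup>\<star>) = 0" by (simp flip: mult.assoc)
  moreover have "(d * d\<^sup>\<star>)\<^sup>\<star> = d * d\<^sup>\<star>" by (simp add: adj_mult adj_adj)
  ultimately have "norm (d * d\<^sup>\<star>) = 0" by (metis norm_square_sa norm_zero power_eq_0_iff)
  then have "norm d = 0" by (simp add: norm_mult_adj)
  then show ?thesis by (simp add: d_def)
qed

section \<open>The action of multipliers on the slice\<close>

context
  fixes \<mu> :: "'a multiplier"
  assumes \<mu>: "\<mu> \<in> multiplier_algebra I"
begin

text \<open>Independence of the factorization: multiplied by \<open>c\<close> from the left, the
  value becomes \<open>snd \<mu> c\<close> times the product \<open>a * n\<close>.\<close>

lemma slice_action_eq:
  assumes "a \<in> I" "n \<in> M"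
  shows "slice_action M \<mu> (a * n) = fst \<mu> a * n"
  unfolding slice_action_def
proof (rule the_equality)
  show "\<exists>a'\<in>I. \<exists>n'\<in>M. a * n = a' * n' \<and> fst \<mu> a * n = fst \<mu> a' * n'" using assms by blast
  fix x assume "\<exists>a'\<in>I. \<exists>n'\<in>M. a * n = a' * n' \<and> x = fst \<mu> a' * n'"
  then obtain a' n' where a': "a' \<in> I" "n' \<in> M" "a * n = a' * n'" "x = fst \<mu> a' * n'" by blast
  have "c * (fst \<mu> a' * n') = c * (fst \<mu> a * n)" if "c \<in> I" for c
    unfolding mult.assoc[symmetric] multiplier_algebraD(9)[OF \<mu> that assms(1)]
      multiplier_algebraD(9)[OF \<mu> that a'(1)] by (simp add: mult.assoc a'(3))
  then show "x = fst \<mu> a * n"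
    unfolding a'(4) using multiplier_algebraD(5)[OF \<mu>] assms(1) a'(1)
    by (intro M_eqI[OF I_M[OF _ a'(2)] I_M[OF _ assms(2)]]) auto
qed

lemma slice_action_in: assumes "m \<in> M" shows "slice_action M \<mu> m \<in> M"
proof -
  obtain a n where a: "a \<in> I" "n \<in> M" "m = a * n" using M_factor[OF assms] .
  then show ?thesis by (simp add: slice_action_eq multiplier_algebraD(5)[OF \<mu>] I_M)
qed

text \<open>With \<open>M_eqI\<close> this characterizes the action without reference to a
  factorization, which makes its algebraic rules immediate.\<close>

lemma mult_slice_action:
  assumes "m \<in> M" "c \<in> I" shows "c * slice_action M \<mu> m = snd \<mu> c * m"
proof -
  obtain a n where a: "a \<in> I" "n \<in> M" "m = a * n" using M_factor[OF assms(1)] .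
  then show ?thesis
    using multiplier_algebraD(9)[OF \<mu> assms(2) a(1)]
    by (simp add: slice_action_eq flip: mult.assoc)
qed

lemma slice_action_mult_adj:
  assumes "m \<in> M" "n \<in> M" shows "slice_action M \<mu> m * n\<^sup>\<star> = fst \<mu> (m * n\<^sup>\<star>)"
proof -
  obtain a k where a: "a \<in> I" "k \<in> M" "m = a * k" using M_factor[OF assms(1)] .
  have "fst \<mu> (a * (k * n\<^sup>\<star>)) = fst \<mu> a * (k * n\<^sup>\<star>)"
    by (rule multiplier_algebraD(7)[OF \<mu> a(1) M_adj_in_I[OF a(2) assms(2)]])
  then show ?thesis using slice_action_eq[OF a(1,2)] a(3) by (simp add: mult.assoc)
qed

lemma slice_action_add:
  "m \<in> M \<Longrightarrow> n \<in> M \<Longrightarrow> slice_action M \<mu> (m + n) = slice_action M \<mu> m + slice_action M \<mu> n"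
  by (rule M_eqI)
    (simp_all add: mult_slice_action slice_action_in cvec.subspace_add csubspace_M distrib_left)

lemma slice_action_scaleC:
  "m \<in> M \<Longrightarrow> slice_action M \<mu> (c *\<^sub>C m) = c *\<^sub>C slice_action M \<mu> m"
  by (rule M_eqI)
    (simp_all add: mult_slice_action slice_action_in cvec.subspace_scale csubspace_M mult_scaleC_right)

lemma slice_action_diff:
  assumes "m \<in> M" "n \<in> M"
  shows "slice_action M \<mu> (m - n) = slice_action M \<mu> m - slice_action M \<mu> n"
  by (rule M_eqI) (simp_all add: assms mult_slice_action slice_action_in cvec.subspace_diff
      csubspace_M right_diff_distrib)

lemma slice_action_mult_right:
  assumes "m \<in> M" "b \<in> B" shows "slice_action M \<mu> (m * b) = slice_action M \<mu> m * b"
  by (rule M_eqI)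
    (simp_all add: assms mult_slice_action slice_action_in M_B flip: mult.assoc)

end

lemma multiplier_mult_right:
  assumes \<mu>: "\<mu> \<in> multiplier_algebra I" and "x \<in> I" "b \<in> B"
  shows "fst \<mu> (x * b) = fst \<mu> x * b"
proof (rule eq_if_mult_right_eq[OF closed_star_subalgebra_I])
  show "fst \<mu> (x * b) \<in> I" "fst \<mu> x * b \<in> I"
    using assms by (simp_all add: multiplier_algebraD(5)[OF \<mu>] I_B)
  fix w assume w: "w \<in> I"
  show "fst \<mu> (x * b) * w = fst \<mu> x * b * w"
    using multiplier_algebraD(7)[OF \<mu> I_B[OF assms(2,3)] w]
      multiplier_algebraD(7)[OF \<mu> assms(2) B_I[OF assms(3) w]] by (simp add: mult.assoc)
qed

text \<open>Elements of \<open>B\<close> act as multipliers of the ideal; this is how centrality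
  turns into commutation with \<open>B\<close>.\<close>

lemma left_right_multiplication_in:
  assumes "b \<in> B"
  shows "(\<lambda>x\<in>I. b * x, \<lambda>x\<in>I. x * b) \<in> multiplier_algebra I"
proof -
  have "clinear_on I (\<lambda>x\<in>I. b * x)" "clinear_on I (\<lambda>x\<in>I. x * b)"
    by (simp_all add: clinear_on_def csubspace_I cvec.subspace_add cvec.subspace_scale
        distrib_left distrib_right mult_scaleC_left mult_scaleC_right)
  moreover have "\<exists>K. \<forall>x\<in>I. norm ((\<lambda>x\<in>I. b * x) x) \<le> K * norm x"
    "\<exists>K. \<forall>x\<in>I. norm ((\<lambda>x\<in>I. x * b) x) \<le> K * norm x"
    by (intro exI[of _ "norm b"]; simp add: norm_mult_ineq)
      (intro exI[of _ "norm b"]; simp, metis norm_mult_ineq mult.commute)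
  moreover have "x * y \<in> I" if "x \<in> I" "y \<in> I" for x y using that I_subset_B B_I by blast
  ultimately show ?thesis
    using assms by (auto simp: multiplier_algebra_def bounded_clinear_on_def B_I I_B mult.assoc)
qed

section \<open>Central multipliers\<close>

context
  fixes \<mu> :: "'a multiplier"
  assumes \<mu>: "\<mu> \<in> multiplier_algebra I" and central: "mult_central I \<mu>"
begin

lemma central_multiplier_commute:
  assumes "b \<in> B" "x \<in> I"
  shows "fst \<mu> (b * x) = b * fst \<mu> x" "snd \<mu> (x * b) = snd \<mu> x * b"
proof -
  let ?\<nu> = "(\<lambda>x\<in>I. b * x, \<lambda>x\<in>I. x * b)"
  have eq: "mult_times I \<mu> ?\<nu> = mult_times I ?\<nu> \<mu>"
    using central left_right_multiplication_in[OF assms(1)] by (simp add: mult_central_def)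
  show "fst \<mu> (b * x) = b * fst \<mu> x"
    using fun_cong[OF arg_cong[OF eq, of fst], of x] assms multiplier_algebraD(5)[OF \<mu>]
    by (simp add: mult_times_def compose_eq)
  show "snd \<mu> (x * b) = snd \<mu> x * b"
    using fun_cong[OF arg_cong[OF eq, of snd], of x] assms multiplier_algebraD(6)[OF \<mu>]
    by (simp add: mult_times_def compose_eq)
qed

lemma central_multiplier_fst_eq_snd:
  assumes "x \<in> I" shows "fst \<mu> x = snd \<mu> x"
proof (rule eq_if_mult_right_eq[OF closed_star_subalgebra_I])
  fix w assume w: "w \<in> I"
  then show "fst \<mu> x * w = snd \<mu> x * w"
    using multiplier_algebraD(7,9)[OF \<mu> assms w] central_multiplier_commute(1)[of x w]
      assms I_subset_B by auto
qed (use assms multiplier_algebraD[OF \<mu>] in auto)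

lemma slice_action_mult_left:
  assumes "m \<in> M" "b \<in> B" shows "slice_action M \<mu> (b * m) = b * slice_action M \<mu> m"
proof (rule M_eqI)
  show "slice_action M \<mu> (b * m) \<in> M" "b * slice_action M \<mu> m \<in> M"
    using assms by (simp_all add: B_M slice_action_in \<mu>)
  fix c assume c: "c \<in> I"
  have "c * (b * slice_action M \<mu> m) = snd \<mu> (c * b) * m"
    using mult_slice_action[OF \<mu> assms(1) I_B[OF c assms(2)]] by (simp add: mult.assoc)
  also have "\<dots> = c * slice_action M \<mu> (b * m)"
    using c assms by (simp add: central_multiplier_commute mult_slice_action \<mu> B_M mult.assoc)
  finally show "c * slice_action M \<mu> (b * m) = c * (b * slice_action M \<mu> m)" by simp
qed

text \<open>Writing \<mu> as \<open>v\<^sup>\<star> * v\<close> makes the form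
  \<open>(fst \<mu> y)\<^sup>\<star> * z\<close> Hermitian; centrality lets \<mu> pass from one
  factor to the other.\<close>

lemma positive_central_multiplier_adj:
  assumes "mult_positive I \<mu>" "x \<in> I"
  shows "(fst \<mu> x)\<^sup>\<star> = fst \<mu> (x\<^sup>\<star>)"
proof -
  obtain v where v: "v \<in> multiplier_algebra I" "\<mu> = mult_times I (mult_adj I v) v"
    using assms(1) by (auto simp: mult_positive_def)
  have form: "(fst \<mu> y)\<^sup>\<star> * z = (fst v y)\<^sup>\<star> * fst v z" if "y \<in> I" "z \<in> I" for y z
    using that multiplier_algebraD(5)[OF v(1)] multiplier_algebraD(9)[OF v(1) adj_I]
    by (simp add: v(2) mult_times_def mult_adj_def compose_eq adj_adj)
  show ?thesis
  proof (rule eq_if_mult_right_eq[OF closed_star_subalgebra_I])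
    show "(fst \<mu> x)\<^sup>\<star> \<in> I" "fst \<mu> (x\<^sup>\<star>) \<in> I"
      using assms(2) by (simp_all add: adj_I multiplier_algebraD(5)[OF \<mu>])
    fix w assume w: "w \<in> I"
    have "(fst \<mu> x)\<^sup>\<star> * w = ((fst \<mu> w)\<^sup>\<star> * x)\<^sup>\<star>"
      unfolding form[OF assms(2) w] form[OF w assms(2)] by (simp add: adj_mult adj_adj)
    also have "\<dots> = x\<^sup>\<star> * fst \<mu> w" by (simp add: adj_mult adj_adj)
    also have "\<dots> = fst \<mu> (x\<^sup>\<star>) * w"
      using multiplier_algebraD(9)[OF \<mu> adj_I[OF assms(2)] w]
        central_multiplier_fst_eq_snd[OF adj_I[OF assms(2)]] by simp
    finally show "(fst \<mu> x)\<^sup>\<star> * w = fst \<mu> (x\<^sup>\<star>) * w" .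
  qed
qed

text \<open>For the root of \<tau> the right side is \<open>P m * P (n\<^sup>\<star>)\<close>, the
  source of the isometry.\<close>

lemma slice_action_mult_adj_slice_action:
  assumes "mult_positive I \<mu>" "m \<in> M" "n \<in> M"
  shows "slice_action M \<mu> m * (slice_action M \<mu> n)\<^sup>\<star> = fst (mult_times I \<mu> \<mu>) (m * n\<^sup>\<star>)"
proof -
  have mn: "m * n\<^sup>\<star> \<in> I" using assms by (simp add: M_adj_in_I)
  have "m * (slice_action M \<mu> n)\<^sup>\<star> = (fst \<mu> (n * m\<^sup>\<star>))\<^sup>\<star>"
    using slice_action_mult_adj[OF \<mu> assms(3,2)] by (metis adj_adj adj_mult)
  also have "\<dots> = fst \<mu> (m * n\<^sup>\<star>)"
    using assms by (simp add: positive_central_multiplier_adj M_adj_in_I adj_mult adj_adj)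
  finally show ?thesis
    using slice_action_mult_adj[OF \<mu> assms(2) slice_action_in[OF \<mu> assms(3)]] mn
    by (simp add: mult_times_def compose_eq)
qed

end

end

section \<open>The virtual commutant\<close>

text \<open>Where \<open>p\<close> converges along a sequence, \<open>q\<close> is Cauchy, and two
  sequences with the same limit under \<open>p\<close> have differences under \<open>q\<close>
  tending to 0. Constant sequences give the value at \<open>p m\<close> itself.\<close>

lemma isometric_extension:
  fixes p q :: "'b \<Rightarrow> 'a::banach"
  assumes "\<And>m n. m \<in> M \<Longrightarrow> n \<in> M \<Longrightarrow> norm (q m - q n) = norm (p m - p n)"
  shows "\<exists>\<phi>. \<forall>s x. (\<forall>i::nat. s i \<in> M) \<and> (\<lambda>i. p (s i)) \<longlonglongrightarrow> x \<longrightarrow> (\<lambda>i. q (s i)) \<longlonglongrightarrow> \<phi> x"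
proof -
  let ?R = "\<lambda>s x. (\<forall>i::nat. s i \<in> M) \<and> (\<lambda>i. p (s i)) \<longlonglongrightarrow> x"
  \<comment> \<open>One approximating sequence is chosen for each \<open>x\<close>; where there is
    none the value is arbitrary.\<close>
  define \<phi> where "\<phi> x = lim (\<lambda>i. q ((SOME s. ?R s x) i))" for x
  have conv: "convergent (\<lambda>i. q (s i))" if "?R s x" for s x
  proof -
    have "Cauchy (\<lambda>i. p (s i))" using that LIMSEQ_imp_Cauchy by blast
    then have "Cauchy (\<lambda>i. q (s i))" using that unfolding Cauchy_def dist_norm by (simp add: assms)
    then show ?thesis by (simp add: Cauchy_convergent_iff)
  qed
  have "(\<lambda>i. q (s i)) \<longlonglongrightarrow> \<phi> x" if s: "?R s x" for s x
  proof -
    define t where "t = (SOME s. ?R s x)"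
    have t: "?R t x" unfolding t_def by (rule someI[of "\<lambda>s. ?R s x", OF s])
    have lim: "(\<lambda>i. q (t i)) \<longlonglongrightarrow> \<phi> x"
      using conv[OF t] unfolding \<phi>_def t_def by (simp add: convergent_LIMSEQ_iff)
    have "(\<lambda>i. p (s i) - p (t i)) \<longlonglongrightarrow> x - x" using s t by (intro tendsto_diff) auto
    then have "(\<lambda>i. norm (q (s i) - q (t i))) \<longlonglongrightarrow> 0"
      using s t by (simp add: assms tendsto_norm_zero)
    then have "(\<lambda>i. (q (s i) - q (t i)) + q (t i)) \<longlonglongrightarrow> 0 + \<phi> x"
      by (intro tendsto_add lim) (rule tendsto_norm_zero_cancel)
    then show ?thesis by simp
  qed
  then show ?thesis by blast
qed

theorem proposition11p9:
  fixes B M :: "'a::cstar_algebra set" and P :: "'a \<Rightarrow> 'a" and \<tau> :: "'a multiplier"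
  assumes "separable_space (euclidean :: 'a topology)"
    and "closed_star_subalgebra B"
    and "contains_approximate_unit B"
    and "conditional_expectation B P"
    and "slice B M"
    and "is_tau P M \<tau>"
  shows "closure (P ` M) = closure (fst \<tau> ` slice_ideal M) \<and>
    (\<exists>\<phi>. virtual_commutant B (closure (P ` M)) \<phi> \<and>
       (\<forall>x\<in>closure (P ` M). norm (\<phi> x) = norm x) \<and>
       (\<forall>m\<in>M. \<phi> (P m) = slice_action M (mult_sqrt (slice_ideal M) \<tau>) m) \<and>
       \<phi> ` closure (P ` M) = closure (slice_action M (mult_sqrt (slice_ideal M) \<tau>) ` M))"
proof -
  interpret slice_in B M using assms by unfold_locales
  note P = assms(4)
  have \<tau>: "\<tau> \<in> multiplier_algebra I" "mult_central I \<tau>" "mult_positive I \<tau>"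
    and \<tau>P: "\<And>m n. m \<in> M \<Longrightarrow> n \<in> M \<Longrightarrow> fst \<tau> (m * n\<^sup>\<star>) = P m * P (n\<^sup>\<star>)"
    using assms(6) by (auto simp: is_tau_def)
  note \<sigma> = mult_sqrt_properties[OF closed_star_subalgebra_I \<tau>]
  let ?act = "slice_action M (mult_sqrt I \<tau>)"
  note Padj = conditional_expectation_adj[OF P approx_unit]
  have Plin: "P (u + v) = P u + P v" "P (c *\<^sub>C u) = c *\<^sub>C P u" for u v c
    using P by (simp_all add: conditional_expectation_def clinear_on_def)
  have PB: "P x \<in> B" for x using P by (simp add: conditional_expectation_def)
  have Pmod: "P (b * x) = b * P x" "P (x * b) = P x * b" if "b \<in> B" for b x
    using P that by (simp_all add: conditional_expectation_def)
  have Pdiff: "P (u - v) = P u - P v" for u v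
    by (rule linear_diff[OF bounded_linear.linear[OF conditional_expectation_bounded_linear[OF P]]])
  have norm_act: "norm (?act m) = norm (P m)" if "m \<in> M" for m
  proof -
    have "?act m * (?act m)\<^sup>\<star> = P m * (P m)\<^sup>\<star>"
      using slice_action_mult_adj_slice_action[OF \<sigma>(1,4,2) that that] \<tau>P[OF that that]
      by (simp add: \<sigma>(3) Padj)
    then have "(norm (?act m))\<^sup>2 = (norm (P m))\<^sup>2" by (simp flip: norm_mult_adj)
    then show ?thesis by simp
  qed
  have "norm (?act m - ?act n) = norm (P m - P n)" if "m \<in> M" "n \<in> M" for m n
    using norm_act[OF cvec.subspace_diff[OF csubspace_M that]]
    by (simp add: Pdiff slice_action_diff[OF \<sigma>(1) that])
  note dist_act = this
  obtain \<phi> where lim: "\<forall>s x. (\<forall>i::nat. s i \<in> M) \<and> (\<lambda>i. P (s i)) \<longlonglongrightarrow> x \<longrightarrow> (\<lambda>i. ?act (s i)) \<longlonglongrightarrow> \<phi> x"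
    using isometric_extension[of M ?act P, OF dist_act] by (rule exE)
  have \<phi>: "(\<lambda>i. ?act (s i)) \<longlonglongrightarrow> \<phi> x" if "\<And>i::nat. s i \<in> M" "(\<lambda>i. P (s i)) \<longlonglongrightarrow> x" for s x
    using lim that by simp
  let ?J = "closure (P ` M)"
  have J_seq: "\<exists>s. (\<forall>i::nat. s i \<in> M) \<and> (\<lambda>i. P (s i)) \<longlonglongrightarrow> x" if "x \<in> ?J" for x
  proof -
    obtain f where f: "\<forall>i::nat. f i \<in> P ` M" "f \<longlonglongrightarrow> x"
      using \<open>x \<in> ?J\<close> unfolding closure_sequential by blast
    then have "\<forall>i. \<exists>m. m \<in> M \<and> f i = P m" by blast
    then obtain s where s: "\<And>i. s i \<in> M" "\<And>i. f i = P (s i)" by metis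
    have "f = (\<lambda>i. P (s i))" by (simp add: fun_eq_iff s(2))
    then show ?thesis using f(2) s(1) by blast
  qed
  have J_I: "x \<in> ?J" if "\<And>i::nat. s i \<in> M" "(\<lambda>i. P (s i)) \<longlonglongrightarrow> x" for s x
    unfolding closure_sequential using that by (intro exI[of _ "\<lambda>i. P (s i)"]) auto
  have csJ: "csubspace ?J"
  proof (rule csubspace_closure)
    show "csubspace (P ` M)"
      unfolding cvec.subspace_def using csubspace_M
      by (auto simp flip: Plin intro!: imageI cvec.subspace_add cvec.subspace_scale)
        (metis Pdiff diff_self cvec.subspace_0 imageI)
  qed
  have ideal: "closed_ideal B ?J"
    unfolding closed_ideal_def
  proof (intro conjI ballI)
    show "?J \<subseteq> B" using PB by (intro closure_minimal closed_B) auto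
    fix b x assume b: "b \<in> B" and "x \<in> ?J"
    then obtain s where s: "\<And>i::nat. s i \<in> M" "(\<lambda>i. P (s i)) \<longlonglongrightarrow> x" using J_seq by blast
    show "b * x \<in> ?J"
      using s(1) b tendsto_mult_left[OF s(2), of b]
      by (intro J_I[of "\<lambda>i. b * s i"]) (simp_all add: B_M Pmod)
    show "x * b \<in> ?J"
      using s(1) b tendsto_mult_right[OF s(2), of b]
      by (intro J_I[of "\<lambda>i. s i * b"]) (simp_all add: M_B Pmod)
  qed (simp_all add: csJ)
  have "clinear_on ?J \<phi>"
    unfolding clinear_on_def
  proof (intro conjI ballI allI)
    fix x assume "x \<in> ?J"
    then obtain s where s: "\<And>i::nat. s i \<in> M" "(\<lambda>i. P (s i)) \<longlonglongrightarrow> x" using J_seq by blast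
    show "\<phi> (c *\<^sub>C x) = c *\<^sub>C \<phi> x" for c
    proof (rule LIMSEQ_unique)
      show "(\<lambda>i. ?act (c *\<^sub>C s i)) \<longlonglongrightarrow> \<phi> (c *\<^sub>C x)"
        using s tendsto_scaleC[OF s(2), of c]
        by (intro \<phi>) (simp_all add: Plin cvec.subspace_scale csubspace_M)
      show "(\<lambda>i. ?act (c *\<^sub>C s i)) \<longlonglongrightarrow> c *\<^sub>C \<phi> x"
        using tendsto_scaleC[OF \<phi>[OF s], of c] by (simp add: slice_action_scaleC \<sigma>(1) s(1))
    qed
    fix y assume "y \<in> ?J"
    then obtain t where t: "\<And>i::nat. t i \<in> M" "(\<lambda>i. P (t i)) \<longlonglongrightarrow> y" using J_seq by blast
    show "\<phi> (x + y) = \<phi> x + \<phi> y"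
    proof (rule LIMSEQ_unique)
      show "(\<lambda>i. ?act (s i + t i)) \<longlonglongrightarrow> \<phi> (x + y)"
        using s t tendsto_add[OF s(2) t(2)]
        by (intro \<phi>) (simp_all add: Plin cvec.subspace_add csubspace_M)
      show "(\<lambda>i. ?act (s i + t i)) \<longlonglongrightarrow> \<phi> x + \<phi> y"
        using tendsto_add[OF \<phi>[OF s] \<phi>[OF t]] by (simp add: slice_action_add \<sigma>(1) s(1) t(1))
    qed
  qed
  moreover have "\<phi> (b * x) = b * \<phi> x \<and> \<phi> (x * b) = \<phi> x * b" if "x \<in> ?J" and b: "b \<in> B" for x b
  proof -
    obtain s where s: "\<And>i::nat. s i \<in> M" "(\<lambda>i. P (s i)) \<longlonglongrightarrow> x"
      using J_seq[OF \<open>x \<in> ?J\<close>] by blast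
    have "(\<lambda>i. ?act (b * s i)) \<longlonglongrightarrow> \<phi> (b * x)" "(\<lambda>i. ?act (s i * b)) \<longlonglongrightarrow> \<phi> (x * b)"
      using s b tendsto_mult_left[OF s(2), of b] tendsto_mult_right[OF s(2), of b]
      by (auto intro!: \<phi> simp: B_M M_B Pmod)
    moreover have "(\<lambda>i. ?act (b * s i)) \<longlonglongrightarrow> b * \<phi> x" "(\<lambda>i. ?act (s i * b)) \<longlonglongrightarrow> \<phi> x * b"
      using tendsto_mult_left[OF \<phi>[OF s], of b] tendsto_mult_right[OF \<phi>[OF s], of b] s(1) b
      by (simp_all add: slice_action_mult_left slice_action_mult_right \<sigma>)
    ultimately show ?thesis using LIMSEQ_unique by blast
  qed
  ultimately have vc: "virtual_commutant B ?J \<phi>"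
    using ideal by (simp add: virtual_commutant_def)
  have iso: "norm (\<phi> x) = norm x" if x: "x \<in> ?J" for x
  proof -
    obtain s where s: "\<And>i::nat. s i \<in> M" "(\<lambda>i. P (s i)) \<longlonglongrightarrow> x" using J_seq[OF x] by blast
    show ?thesis
      using LIMSEQ_unique[OF tendsto_norm[OF \<phi>[OF s]]] tendsto_norm[OF s(2)]
      by (simp add: norm_act s(1))
  qed
  have val: "\<phi> (P m) = ?act m" if "m \<in> M" for m
    using \<phi>[of "\<lambda>i. m" "P m"] that by (simp add: LIMSEQ_const_iff)
  have range: "\<phi> ` ?J = closure (?act ` M)"
  proof (intro equalityI subsetI)
    fix y assume "y \<in> \<phi> ` ?J"
    then obtain x where x: "x \<in> ?J" "y = \<phi> x" by blast
    obtain s where s: "\<And>i::nat. s i \<in> M" "(\<lambda>i. P (s i)) \<longlonglongrightarrow> x" using J_seq[OF x(1)] by blast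
    show "y \<in> closure (?act ` M)"
      unfolding closure_sequential x(2) using \<phi>[OF s] s(1)
      by (intro exI[of _ "\<lambda>i. ?act (s i)"]) auto
  next
    fix y assume "y \<in> closure (?act ` M)"
    then obtain f where f: "\<forall>i::nat. f i \<in> ?act ` M" "f \<longlonglongrightarrow> y"
      unfolding closure_sequential by blast
    then have "\<forall>i. \<exists>m. m \<in> M \<and> f i = ?act m" by blast
    then obtain s where s: "\<And>i. s i \<in> M" "\<And>i. f i = ?act (s i)" by metis
    \<comment> \<open>The isometry read backwards: convergence of the images makes the arguments
      Cauchy, so the range is closed.\<close>
    have "norm (P (s i) - P (s j)) = norm (f i - f j)" for i j
      using dist_act[OF s(1) s(1), of i j] by (simp add: s(2))
    then have "Cauchy (\<lambda>i. P (s i))"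
      using LIMSEQ_imp_Cauchy[OF f(2)] by (simp add: Cauchy_def dist_norm)
    then obtain x where x: "(\<lambda>i. P (s i)) \<longlonglongrightarrow> x" using Cauchy_convergent_iff convergent_def by blast
    have "(\<lambda>i. ?act (s i)) \<longlonglongrightarrow> \<phi> x" by (rule \<phi>[OF s(1) x])
    moreover have "f = (\<lambda>i. ?act (s i))" by (simp add: fun_eq_iff s(2))
    ultimately have "y = \<phi> x" using f(2) LIMSEQ_unique by blast
    then show "y \<in> \<phi> ` ?J" using J_I[OF s(1) x] by blast
  qed
  obtain K where K: "\<And>x. x \<in> I \<Longrightarrow> norm (fst \<tau> x) \<le> K * norm x"
    using multiplier_algebraD(3)[OF \<tau>(1)] unfolding bounded_clinear_on_def by blast
  have \<tau>lin: "fst \<tau> (x + y) = fst \<tau> x + fst \<tau> y" "fst \<tau> (c *\<^sub>C x) = c *\<^sub>C fst \<tau> x"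
    if "x \<in> I" "y \<in> I" for x y c
    using multiplier_algebraD(3)[OF \<tau>(1)] that unfolding bounded_clinear_on_def clinear_on_def by auto
  have "fst \<tau> ` I \<subseteq> ?J"
  proof -
    let ?S = "{x \<in> I. fst \<tau> x \<in> ?J}"
    have sub: "csubspace ?S"
      using csubspace_I csJ \<tau>lin(2)[of 0 0 0]
      unfolding cvec.subspace_def by (auto simp: \<tau>lin)
    \<comment> \<open>\<open>fst \<tau>\<close> is known to be linear and bounded on the ideal only,
      so closedness is checked along sequences there.\<close>
    have "closed ?S"
      unfolding closed_sequential_limits
    proof (intro allI impI, elim conjE)
      fix X l assume X: "\<forall>n. X n \<in> ?S" and l: "X \<longlonglongrightarrow> l"
      have lI: "l \<in> I" using X closed_sequentially[OF closed_I _ l] by blast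
      have bound: "norm (fst \<tau> (X n) - fst \<tau> l) \<le> norm (X n - l) * K" for n
      proof -
        have d: "X n - l \<in> I" using X lI csubspace_I by (simp add: cvec.subspace_diff)
        have "fst \<tau> (X n) = fst \<tau> (X n - l) + fst \<tau> l" using \<tau>lin(1)[OF d lI] by simp
        then show ?thesis using K[OF d] by (simp add: mult.commute)
      qed
      have "(\<lambda>n. norm (X n - l) * K) \<longlonglongrightarrow> 0"
        using l by (intro tendsto_mult_left_zero tendsto_norm_zero LIM_zero)
      then have "(\<lambda>n. fst \<tau> (X n) - fst \<tau> l) \<longlonglongrightarrow> 0"
        by (rule Lim_null_comparison[OF always_eventually, rotated]) (simp add: bound)
      then have "(\<lambda>n. fst \<tau> (X n)) \<longlonglongrightarrow> fst \<tau> l" by (rule LIM_zero_cancel)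
      then have "fst \<tau> l \<in> ?J"
        by (rule closed_sequentially[OF closed_closure, rotated]) (use X in blast)
      then show "l \<in> ?S" using lI by simp
    qed
    moreover have "m * n\<^sup>\<star> \<in> ?S" if "m \<in> M" "n \<in> M" for m n
    proof -
      have "fst \<tau> (m * n\<^sup>\<star>) = P (m * P (n\<^sup>\<star>))" using that by (simp add: \<tau>P Pmod PB)
      then show ?thesis
        using that M_adj_in_I M_B PB closure_subset[of "P ` M"] by auto
    qed
    ultimately have "I \<subseteq> ?S" using sub by (intro I_minimal)
    then show ?thesis by blast
  qed
  moreover have "P ` M \<subseteq> closure (fst \<tau> ` I)"
  proof
    let ?C = "closure (fst \<tau> ` I)"
    fix x assume "x \<in> P ` M"
    then obtain m where m: "m \<in> M" "x = P m" by blast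
    have CB: "?C \<subseteq> B"
      using multiplier_algebraD(5)[OF \<tau>(1)] I_subset_B by (intro closure_minimal closed_B) auto
    \<comment> \<open>This right ideal property is used twice: with \<open>?C \<subseteq> B\<close>
      it makes \<open>?C\<close> an algebra, and at the end it puts \<open>c * n\<close> into
      \<open>?C\<close>.\<close>
    have Cb: "y * b \<in> ?C" if "y \<in> ?C" "b \<in> B" for y b
    proof -
      have "(\<lambda>y. y * b) ` (fst \<tau> ` I) \<subseteq> fst \<tau> ` I"
      proof clarify
        fix a assume a: "a \<in> I"
        have "fst \<tau> a * b = fst \<tau> (a * b)"
          by (rule multiplier_mult_right[OF \<tau>(1) a that(2), symmetric])
        then show "fst \<tau> a * b \<in> fst \<tau> ` I" using I_B[OF a that(2)] by simp
      qed
      then have "(\<lambda>y. y * b) ` ?C \<subseteq> ?C"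
        by (intro image_closure_subset continuous_intros closed_closure subset_trans[OF _ closure_subset])
      then show ?thesis using that by blast
    qed
    have "csubspace ?C"
      using csubspace_I
      by (intro csubspace_closure)
        (auto simp: cvec.subspace_def simp flip: \<tau>lin, metis \<tau>lin(2) cvec.scale_zero_left imageI)
    then have "closed_subalgebra ?C"
      using Cb CB by (auto simp: closed_subalgebra_def csubspace_imp_subspace)
    moreover have "x * x\<^sup>\<star> \<in> ?C"
      using \<tau>P[OF m(1) m(1)] M_adj_in_I[OF m(1) m(1)] closure_subset[of "fst \<tau> ` I"]
      by (auto simp: m Padj)
    ultimately obtain c n where "c \<in> ?C" "n \<in> B" "x = c * n"
      using factorization[OF _ _ closed_B csubspace_imp_subspace[OF csubspace_B]] CB B_mult PB m(2)
      by (metis subsetD)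
    then show "x \<in> ?C" using Cb by simp
  qed
  ultimately have "?J = closure (fst \<tau> ` I)"
    by (intro equalityI closure_minimal) auto
  then show ?thesis using vc iso val range by blast
qed

end
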